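(* Let $$\Theta=\begin{pmatrix}\mathbb{A}&K&1\\ \mathcal{H}_+\subset\mathcal{H}\subset\mathcal{H}_-& &\mathbb{C}\end{pmatrix}$$ be an L-system whose main operator $T$ has the von Neumann parameter $\kappa$, $0\le\kappa<1$. Then its impedance function $V_\Theta(z)$ belongs to the Donoghue class $\mathfrak{M}$ if and only if $\kappa=0$.
   Context: Rigged space. $\dot A$ is a closed densely defined symmetric operator with deficiency indices $(1,1)$ in a Hilbert space $\mathcal{H}$ with inner product $(\cdot,\cdot)$ (linear in the first argument). $\mathcal{H}_+=\mathrm{Dom}(\dot A^* )$ with $(f,g)_+=(f,g)+(\dot A^*f,\dot A^*g)$; $\mathcal{H}_-$ is the space dual to $\mathcal{H}_+$ with respect to $\mathcal{H}$, so $\mathcal{H}_+\subset\mathcal{H}\subset\mathcal{H}_-$, and $(u,f)$ denotes the value of $f\in\mathcal{H}_-$ at $u\in\mathcal{H}_+$ (equal to the $\mathcal{H}$-inner product if $f\in\mathcal{H}$). $[X,Y]$ is the set of bounded linear operators $X\to Y$. Spaces dual to $\mathcal{H}_\pm$ are identified with $\mathcal{H}_\mp$, so $\mathbb{A}\in[\mathcal{H}_+,\mathcal{H}_-]$ has adjoint $\mathbb{A}^*\in[\mathcal{H}_+,\mathcal{H}_-]$; $\operatorname{Re}\mathbb{A}=(\mathbb{A}+\mathbb{A}^* )/2$, $\operatorname{Im}\mathbb{A}=(\mathbb{A}-\mathbb{A}^* )/(2i)$. L-systems. For $\mathbb{B}=\mathbb{B}^*\in[\mathcal{H}_+,\mathcal{H}_-]$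 with $\mathbb{B}\supset\dot A$, its quasi-kernel is the restriction of $\mathbb{B}$ to $\{f\in\mathcal{H}_+:\mathbb{B}f\in\mathcal{H}\}$; $\mathbb{B}$ is a t-self-adjoint bi-extension of $\dot A$ if its quasi-kernel is a self-adjoint operator in $\mathcal{H}$. The class $\Lambda(\dot A)$ consists of operators $T$ with $\dot A\subset T\subset\dot A^*$, $\rho(T)\neq\emptyset$ and $\mathrm{Dom}(\dot A)=\mathrm{Dom}(T)\cap\mathrm{Dom}(T^* )$. A $( * )$-extension of $T\in\Lambda(\dot A)$ is $\mathbb{A}\in[\mathcal{H}_+,\mathcal{H}_-]$ with $\dot A\subset T\subset\mathbb{A}$, $\dot A\subset T^*\subset\mathbb{A}^*$ such that $\operatorname{Re}\mathbb{A}$ is a t-self-adjoint bi-extension of $\dot A$. The array $\Theta$ is an L-system (with $E=\mathbb{C}$, $J=1$) if $\mathbb{A}$ is a $( * )$-extension of some $T\in\Lambda(\dot A)$, $K\in[\mathbb{C},\mathcal{H}_-]$, $K^*\in[\mathcal{H}_+,\mathbb{C}]$, $\operatorname{Im}\mathbb{A}=KK^*$ and $\mathrm{Ran}(K)=\mathrm{Ran}(\operatorname{Im}\mathbb{A})$. $T$, the restriction of $\mathbb{A}$ to $\{f\in\mathcal{H}_+:\mathbb{A}f\in\mathcal{H}\}$, is the main operator. With $\hat A$ the quasi-kernel of $\operatorname{Re}\mathbb{A}$, the impedance function is $V_\Theta(z)=K^*(\operatorname{Re}\mathbb{A}-zI)^{-1}K$, $z\in\rho(\hat A)$ (well defined since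 $\mathrm{Ran}(\operatorname{Re}\mathbb{A}-zI)\supset\mathrm{Ran}(K)$). Von Neumann parameter. $T\neq T^*$ is a maximal dissipative extension of $\dot A$ ($\operatorname{Im}(Tf,f)\ge0$ on $\mathrm{Dom}(T)$), and its von Neumann parameter is the number $\kappa$ such that $g_+-\kappa g_-\in\mathrm{Dom}(T)$, where $g_\pm\in\mathrm{Ker}(\dot A^*\mp iI)$, $\|g_\pm\|=1$; multiplying $g_-$ by a unimodular constant, one always takes $\kappa$ real with $0\le\kappa<1$. No relation between $g_\pm$ and the quasi-kernel of $\operatorname{Re}\mathbb{A}$ is assumed here. Donoghue class. $\mathfrak{M}$ is the class of analytic maps $M:\mathbb{C}_+\to\mathbb{C}_+$ admitting a representation $M(z)=\int_{\mathbb{R}}\left(\frac{1}{\lambda-z}-\frac{\lambda}{1+\lambda^2}\right)d\mu(\lambda)$ with an infinite Borel measure $\mu$ (i.e. $\mu(\mathbb{R})=\infty$) such that $\int_{\mathbb{R}}\frac{d\mu(\lambda)}{1+\lambda^2}=1$ (equivalently $M(i)=i$). $V_\Theta\in\mathfrak{M}$ means that the restriction of $V_\Theta$ to $\mathbb{C}_+$ is in $\mathfrak{M}$. *)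

theory Defs
  imports "HOL-Analysis.Analysis" "HOL-Library.Function_Algebras"
begin

section \<open>Complex vector spaces and complex Hilbert spaces\<close>

class scaleC =
  fixes scaleC :: "complex \<Rightarrow> 'a \<Rightarrow> 'a"  (infixr "*\<^sub>C" 75)

class complex_vector = scaleC + ab_group_add +
  assumes scaleC_add_right: "a *\<^sub>C (x + y) = a *\<^sub>C x + a *\<^sub>C y"
    and scaleC_add_left: "(a + b) *\<^sub>C x = a *\<^sub>C x + b *\<^sub>C x"
    and scaleC_scaleC: "a *\<^sub>C (b *\<^sub>C x) = (a * b) *\<^sub>C x"
    and scaleC_one: "1 *\<^sub>C x = x"

global_interpretation complex_vector:
  vector_space "scaleC :: complex \<Rightarrow> 'a \<Rightarrow> 'a :: complex_vector"
  defines csubspace = complex_vector.subspace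
    and cspan = complex_vector.span
    and cdim = complex_vector.dim
  by unfold_locales
    (simp_all add: scaleC_add_right scaleC_add_left scaleC_scaleC scaleC_one)

instantiation complex :: complex_vector
begin
definition "a *\<^sub>C x = a * (x :: complex)"
instance
  by standard (simp_all add: scaleC_complex_def algebra_simps)
end

instantiation prod :: (complex_vector, complex_vector) complex_vector
begin
definition "a *\<^sub>C x = (a *\<^sub>C fst x, a *\<^sub>C snd x)"
instance
  by standard (simp_all add: scaleC_prod_def scaleC_add_right scaleC_add_left
    scaleC_scaleC scaleC_one)
end

instantiation "fun" :: (type, complex_vector) complex_vector
begin
definition "a *\<^sub>C f = (\<lambda>x. a *\<^sub>C f x)"
instance
  by standard (simp_all add: scaleC_fun_def fun_eq_iff scaleC_add_right scaleC_add_left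
    scaleC_scaleC scaleC_one)
end

text \<open>The inner product is linear in the first argument.\<close>

class chilbert_space = complex_vector + banach +
  fixes cinner :: "'a \<Rightarrow> 'a \<Rightarrow> complex"
  assumes scaleR_scaleC: "r *\<^sub>R x = complex_of_real r *\<^sub>C x"
    and cinner_add_left: "cinner (x + y) z = cinner x z + cinner y z"
    and cinner_scaleC_left: "cinner (a *\<^sub>C x) y = a * cinner x y"
    and cinner_commute: "cinner x y = cnj (cinner y x)"
    and cinner_self: "cinner x x = complex_of_real ((norm x)\<^sup>2)"

instantiation complex :: chilbert_space
begin
definition "cinner x y = x * cnj (y :: complex)"
instance
  by standard (simp_all add: scaleC_complex_def cinner_complex_def scaleR_conv_of_real
    algebra_simps complex_norm_square[symmetric])
end

definition clinear_on :: "'a::complex_vector set \<Rightarrow> ('a \<Rightarrow> 'b::complex_vector) \<Rightarrow> bool" where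
  "clinear_on X F \<longleftrightarrow>
     (\<forall>x\<in>X. \<forall>y\<in>X. F (x + y) = F x + F y) \<and> (\<forall>c. \<forall>x\<in>X. F (c *\<^sub>C x) = c *\<^sub>C F x)"

text \<open>\<open>bounded_ops X nX Y nY\<close> is the set \<open>[X, Y]\<close> of bounded linear operators, where the
  spaces \<open>X\<close>, \<open>Y\<close> are linear subspaces of types and carry the norms \<open>nX\<close>, \<open>nY\<close>. Only the
  values on \<open>X\<close> are constrained.\<close>

definition bounded_ops ::
  "'a::complex_vector set \<Rightarrow> ('a \<Rightarrow> real) \<Rightarrow> 'b::complex_vector set \<Rightarrow> ('b \<Rightarrow> real)
    \<Rightarrow> ('a \<Rightarrow> 'b) set" where
  "bounded_ops X nX Y nY =
     {F. clinear_on X F \<and> F ` X \<subseteq> Y \<and> (\<exists>C. \<forall>x\<in>X. nY (F x) \<le> C * nX x)}"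


section \<open>Unbounded operators in a Hilbert space\<close>

text \<open>An unbounded operator is represented by its graph, so that \<open>\<subseteq>\<close> is extension of operators
  and \<^const>\<open>Domain\<close> is the domain.\<close>

definition linear_operator :: "('h::chilbert_space \<times> 'h) set \<Rightarrow> bool" where
  "linear_operator T \<longleftrightarrow> csubspace T \<and> single_valued T"

definition densely_defined :: "('h::chilbert_space \<times> 'h) set \<Rightarrow> bool" where
  "densely_defined T \<longleftrightarrow> closure (Domain T) = UNIV"

text \<open>For densely defined \<open>T\<close> this is the graph of the Hilbert space adjoint.\<close>

definition adj :: "('h::chilbert_space \<times> 'h) set \<Rightarrow> ('h \<times> 'h) set" where
  "adj T = {(g, h). \<forall>(f, f') \<in> T. cinner f' g = cinner f h}"

definition symmetric_operator :: "('h::chilbert_space \<times> 'h) set \<Rightarrow> bool" where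
  "symmetric_operator T \<longleftrightarrow> (\<forall>(f, f') \<in> T. \<forall>(g, g') \<in> T. cinner f' g = cinner f g')"

definition self_adjoint :: "('h::chilbert_space \<times> 'h) set \<Rightarrow> bool" where
  "self_adjoint T \<longleftrightarrow> linear_operator T \<and> densely_defined T \<and> adj T = T"

definition op_kernel :: "('h::chilbert_space \<times> 'h) set \<Rightarrow> complex \<Rightarrow> 'h set" where
  "op_kernel T z = {f. \<exists>f'. (f, f') \<in> T \<and> f' - z *\<^sub>C f = 0}"

text \<open>\<^const>\<open>cdim\<close> is \<open>0\<close> for infinite-dimensional subspaces, so only positive values of the
  components are meaningful without further assumptions.\<close>

definition deficiency_indices :: "('h::chilbert_space \<times> 'h) set \<Rightarrow> nat \<times> nat" where
  "deficiency_indices A = (cdim (op_kernel (adj A) \<i>), cdim (op_kernel (adj A) (- \<i>)))"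

text \<open>The set of pairs \<open>(T f - z f, f)\<close> is the graph of the inverse of \<open>T - z I\<close>.\<close>

definition resolvent_set :: "('h::chilbert_space \<times> 'h) set \<Rightarrow> complex set" where
  "resolvent_set T =
     {z. \<exists>R \<in> bounded_ops UNIV norm UNIV norm.
           {(f' - z *\<^sub>C f, f) | f f'. (f, f') \<in> T} = {(h, R h) | h. True}}"

definition dissipative :: "('h::chilbert_space \<times> 'h) set \<Rightarrow> bool" where
  "dissipative T \<longleftrightarrow> (\<forall>(f, f') \<in> T. Im (cinner f' f) \<ge> 0)"

definition maximal_dissipative :: "('h::chilbert_space \<times> 'h) set \<Rightarrow> bool" where
  "maximal_dissipative T \<longleftrightarrow> linear_operator T \<and> dissipative T \<and>
     (\<forall>S. linear_operator S \<longrightarrow> dissipative S \<longrightarrow> T \<subseteq> S \<longrightarrow> S = T)"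


section \<open>The rigged space generated by a symmetric operator\<close>

definition Hplus :: "('h::chilbert_space \<times> 'h) set \<Rightarrow> 'h set" where
  "Hplus A = Domain (adj A)"

definition adj_fun :: "('h::chilbert_space \<times> 'h) set \<Rightarrow> 'h \<Rightarrow> 'h" where
  "adj_fun A f = (THE f'. (f, f') \<in> adj A)"

definition inner_plus :: "('h::chilbert_space \<times> 'h) set \<Rightarrow> 'h \<Rightarrow> 'h \<Rightarrow> complex" where
  "inner_plus A f g = cinner f g + cinner (adj_fun A f) (adj_fun A g)"

definition norm_plus :: "('h::chilbert_space \<times> 'h) set \<Rightarrow> 'h \<Rightarrow> real" where
  "norm_plus A f = sqrt (Re (inner_plus A f f))"

text \<open>The value \<open>(u, \<phi>)\<close> is linear in \<open>u\<close> and antilinear in \<open>\<phi>\<close>. The element \<open>\<phi>\<close> of the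
  negative space is therefore represented by the function \<open>u \<mapsto> (\<phi>, u)\<close>, the conjugate of
  \<open>(u, \<phi>)\<close>, so that the vector space operations of the negative space are pointwise. These functions are
  set to \<open>0\<close> outside the positive space to make the representation unique.\<close>

definition pairing :: "'h \<Rightarrow> ('h::chilbert_space \<Rightarrow> complex) \<Rightarrow> complex" where
  "pairing u \<phi> = cnj (\<phi> u)"

definition Hminus :: "('h::chilbert_space \<times> 'h) set \<Rightarrow> ('h \<Rightarrow> complex) set" where
  "Hminus A = {\<phi>. (\<lambda>u. pairing u \<phi>) \<in> bounded_ops (Hplus A) (norm_plus A) UNIV norm \<and>
                  (\<forall>u. u \<notin> Hplus A \<longrightarrow> \<phi> u = 0)}"

definition norm_minus :: "('h::chilbert_space \<times> 'h) set \<Rightarrow> ('h \<Rightarrow> complex) \<Rightarrow> real" where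
  "norm_minus A \<phi> = (SUP u\<in>Hplus A. cmod (pairing u \<phi>) / norm_plus A u)"

text \<open>The embedding of the Hilbert space into the negative space: \<open>(u, h)\<close> is the inner product.\<close>

definition embed :: "('h::chilbert_space \<times> 'h) set \<Rightarrow> 'h \<Rightarrow> ('h \<Rightarrow> complex)" where
  "embed A h = (\<lambda>u. if u \<in> Hplus A then cinner h u else 0)"

definition ops_plus_minus ::
  "('h::chilbert_space \<times> 'h) set \<Rightarrow> ('h \<Rightarrow> ('h \<Rightarrow> complex)) set" where
  "ops_plus_minus A = bounded_ops (Hplus A) (norm_plus A) (Hminus A) (norm_minus A)"

text \<open>The adjoint is determined by \<open>(u, \<BB>\<^sup>* g) = (\<BB> u, g)\<close>, where \<open>(\<BB> u, g)\<close> is the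
  conjugate of \<open>(g, \<BB> u)\<close>; recall that the represented function at \<open>u\<close> is the conjugate of
  \<open>(u, \<BB>\<^sup>* g)\<close>.\<close>

definition adj_pm ::
  "('h::chilbert_space \<times> 'h) set \<Rightarrow> ('h \<Rightarrow> ('h \<Rightarrow> complex)) \<Rightarrow> ('h \<Rightarrow> ('h \<Rightarrow> complex))" where
  "adj_pm A \<BB> g = (\<lambda>u. if u \<in> Hplus A then pairing g (\<BB> u) else 0)"

definition Re_op ::
  "('h::chilbert_space \<times> 'h) set \<Rightarrow> ('h \<Rightarrow> ('h \<Rightarrow> complex)) \<Rightarrow> ('h \<Rightarrow> ('h \<Rightarrow> complex))" where
  "Re_op A \<BB> f = (1 / 2) *\<^sub>C (\<BB> f + adj_pm A \<BB> f)"

definition Im_op ::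
  "('h::chilbert_space \<times> 'h) set \<Rightarrow> ('h \<Rightarrow> ('h \<Rightarrow> complex)) \<Rightarrow> ('h \<Rightarrow> ('h \<Rightarrow> complex))" where
  "Im_op A \<BB> f = (1 / (2 * \<i>)) *\<^sub>C (\<BB> f - adj_pm A \<BB> f)"

text \<open>\<open>bi_extends A \<BB> T\<close> means \<open>T \<subset> \<BB>\<close>.\<close>

definition bi_extends ::
  "('h::chilbert_space \<times> 'h) set \<Rightarrow> ('h \<Rightarrow> ('h \<Rightarrow> complex)) \<Rightarrow> ('h \<times> 'h) set \<Rightarrow> bool" where
  "bi_extends A \<BB> T \<longleftrightarrow> (\<forall>(f, f') \<in> T. f \<in> Hplus A \<and> \<BB> f = embed A f')"

text \<open>The restriction of \<open>\<BB>\<close> to those \<open>f\<close> with \<open>\<BB> f\<close> in the Hilbert space, as an operator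
  in the Hilbert space.\<close>

definition quasi_kernel ::
  "('h::chilbert_space \<times> 'h) set \<Rightarrow> ('h \<Rightarrow> ('h \<Rightarrow> complex)) \<Rightarrow> ('h \<times> 'h) set" where
  "quasi_kernel A \<BB> = {(f, h). f \<in> Hplus A \<and> \<BB> f = embed A h}"

definition t_self_adjoint_bi_extension ::
  "('h::chilbert_space \<times> 'h) set \<Rightarrow> ('h \<Rightarrow> ('h \<Rightarrow> complex)) \<Rightarrow> bool" where
  "t_self_adjoint_bi_extension A \<BB> \<longleftrightarrow>
     \<BB> \<in> ops_plus_minus A \<and> (\<forall>f\<in>Hplus A. adj_pm A \<BB> f = \<BB> f) \<and> bi_extends A \<BB> A \<and>
     self_adjoint (quasi_kernel A \<BB>)"


section \<open>L-systems\<close>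

definition Lambda_class :: "('h::chilbert_space \<times> 'h) set \<Rightarrow> ('h \<times> 'h) set set" where
  "Lambda_class A =
     {T. linear_operator T \<and> A \<subseteq> T \<and> T \<subseteq> adj A \<and> resolvent_set T \<noteq> {} \<and>
         Domain A = Domain T \<inter> Domain (adj T)}"

definition star_extension ::
  "('h::chilbert_space \<times> 'h) set \<Rightarrow> ('h \<times> 'h) set \<Rightarrow> ('h \<Rightarrow> ('h \<Rightarrow> complex)) \<Rightarrow> bool" where
  "star_extension A T \<AA> \<longleftrightarrow>
     \<AA> \<in> ops_plus_minus A \<and>
     A \<subseteq> T \<and> bi_extends A \<AA> T \<and>
     A \<subseteq> adj T \<and> bi_extends A (adj_pm A \<AA>) (adj T) \<and>
     t_self_adjoint_bi_extension A (Re_op A \<AA>)"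

text \<open>The adjoint of \<open>K \<in> [\<complex>, H\<^sub>-]\<close> is determined by \<open>(K\<^sup>* u) * cnj c = (u, K c)\<close> for all \<open>c\<close>.\<close>

definition adj_K :: "(complex \<Rightarrow> ('h::chilbert_space \<Rightarrow> complex)) \<Rightarrow> 'h \<Rightarrow> complex" where
  "adj_K K u = pairing u (K 1)"

definition L_system ::
  "('h::chilbert_space \<times> 'h) set \<Rightarrow> ('h \<Rightarrow> ('h \<Rightarrow> complex)) \<Rightarrow> (complex \<Rightarrow> ('h \<Rightarrow> complex)) \<Rightarrow> bool"
  where
  "L_system A \<AA> K \<longleftrightarrow>
     (\<exists>T\<in>Lambda_class A. star_extension A T \<AA>) \<and>
     K \<in> bounded_ops UNIV norm (Hminus A) (norm_minus A) \<and>
     adj_K K \<in> bounded_ops (Hplus A) (norm_plus A) UNIV norm \<and>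
     (\<forall>f\<in>Hplus A. Im_op A \<AA> f = K (adj_K K f)) \<and>
     range K = Im_op A \<AA> ` Hplus A"

definition main_operator ::
  "('h::chilbert_space \<times> 'h) set \<Rightarrow> ('h \<Rightarrow> ('h \<Rightarrow> complex)) \<Rightarrow> ('h \<times> 'h) set" where
  "main_operator A \<AA> = quasi_kernel A \<AA>"

text \<open>The impedance function is the value at \<open>1\<close> of the operator
  \<open>K\<^sup>* (Re \<AA> - z I)\<^sup>-\<^sup>1 K\<close> in \<open>\<complex>\<close>. It is meaningful for \<open>z\<close> in the resolvent set of the
  quasi-kernel of \<open>Re \<AA>\<close>, which contains all non-real \<open>z\<close>.\<close>

definition impedance ::
  "('h::chilbert_space \<times> 'h) set \<Rightarrow> ('h \<Rightarrow> ('h \<Rightarrow> complex)) \<Rightarrow> (complex \<Rightarrow> ('h \<Rightarrow> complex))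
    \<Rightarrow> complex \<Rightarrow> complex" where
  "impedance A \<AA> K z =
     adj_K K (inv_into (Hplus A) (\<lambda>f. Re_op A \<AA> f - z *\<^sub>C embed A f) (K 1))"

text \<open>Since \<open>gp\<close> and \<open>gm\<close> range over all unit vectors of the deficiency subspaces, the
  normalization \<open>0 \<le> \<kappa> < 1\<close> determines \<open>\<kappa>\<close> uniquely.\<close>

definition von_Neumann_parameter ::
  "('h::chilbert_space \<times> 'h) set \<Rightarrow> ('h \<times> 'h) set \<Rightarrow> real \<Rightarrow> bool" where
  "von_Neumann_parameter A T \<kappa> \<longleftrightarrow>
     A \<subseteq> T \<and> maximal_dissipative T \<and> T \<noteq> adj T \<and>
     (\<exists>gp gm. gp \<in> op_kernel (adj A) \<i> \<and> norm gp = 1 \<and>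
              gm \<in> op_kernel (adj A) (- \<i>) \<and> norm gm = 1 \<and>
              gp - complex_of_real \<kappa> *\<^sub>C gm \<in> Domain T)"


section \<open>The Donoghue class\<close>

text \<open>Membership only concerns the restriction of a function to the open upper half-plane.\<close>

definition Donoghue_class :: "(complex \<Rightarrow> complex) set" where
  "Donoghue_class =
     {M. M analytic_on {z. Im z > 0} \<and> (\<forall>z. Im z > 0 \<longrightarrow> Im (M z) > 0) \<and>
         (\<exists>\<mu> :: real measure. sets \<mu> = sets borel \<and> emeasure \<mu> UNIV = \<infinity> \<and>
            (\<integral>\<^sup>+ t. ennreal (1 / (1 + t\<^sup>2)) \<partial>\<mu>) = 1 \<and>
            (\<forall>z. Im z > 0 \<longrightarrow>
               M z = (\<integral>t. 1 / (of_real t - z) - of_real (t / (1 + t\<^sup>2)) \<partial>\<mu>)))}"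

end

theory Submission
  imports Defs "HOL-Probability.Probability" "HOL-Real_Asymp.Real_Asymp"
begin

text \<open>Write \<open>S\<close> for the quasi-kernel of \<open>Re \<AA>\<close>, \<open>\<phi> = K 1\<close> and \<open>g = g\<^sub>+\<close>. Since the domain of \<open>S\<close> has
  codimension one in the positive space, \<open>Re \<AA> g = i g + \<eta> \<phi>\<close> for some \<open>\<eta> \<noteq> 0\<close>, whence
  \<open>V(i) = (g, \<phi>) / \<eta>\<close>. On the other hand \<open>\<AA> g = i g + (\<eta> + i (g, \<phi>)) \<phi>\<close>, so that \<open>V(i) = i\<close> means that
  \<open>g\<close> is in the domain of the main operator; by dissipativity this happens only for \<open>\<kappa> = 0\<close>.

  Conversely, \<open>\<kappa> = 0\<close> gives \<open>\<bar>(g, \<phi>)\<bar> = 1\<close> and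
  \<open>V(z) = z + (1 + z\<^sup>2) ((S - z)\<^sup>-\<^sup>1 g, g)\<close>. In terms of the Cayley transform \<open>W = (S + i)(S - i)\<^sup>-\<^sup>1\<close> and
  \<open>w = (z - i)/(z + i)\<close> this is \<open>i (2 \<Sum> w\<^sup>n (W\<^sup>n g, g) - 1)\<close>. By Herglotz' theorem \<open>(W\<^sup>n g, g)\<close> are
  the moments of a probability measure on the circle, which \<open>\<lambda> = cot (s/2)\<close> carries to the line; it
  has no atom at \<open>s = 0\<close> by the mean ergodic theorem, and the resulting measure
  \<open>(1 + \<lambda>\<^sup>2) d\<nu>(\<lambda>)\<close> is infinite because \<open>g\<close> is not in the domain of \<open>S\<close>.\<close>

section \<open>Complex Hilbert spaces and self-adjoint operators\<close>

lemmas scaleC_simps = scaleC_add_right scaleC_add_left scaleC_scaleC scaleC_one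

lemma cinner_add_right: "cinner x (y + z) = cinner x y + cinner x z" for x :: "'h::chilbert_space"
  by (metis cinner_add_left cinner_commute complex_cnj_add)

lemma cinner_scaleC_right: "cinner x (a *\<^sub>C y) = cnj a * cinner x y" for x :: "'h::chilbert_space"
  by (metis cinner_scaleC_left cinner_commute complex_cnj_mult)

lemma scaleC_minus_one: "(- 1) *\<^sub>C x = - x" for x :: "'a::complex_vector"
  by (simp add: complex_vector.scale_minus_left scaleC_one)

lemma cinner_minus_left: "cinner (- x) y = - cinner x y" for x :: "'h::chilbert_space"
  using cinner_scaleC_left[of "-1" x y] by (simp add: scaleC_minus_one)

lemma cinner_minus_right: "cinner x (- y) = - cinner x y" for x :: "'h::chilbert_space"
  using cinner_scaleC_right[of x "-1" y] by (simp add: scaleC_minus_one)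

lemma cinner_diff_left: "cinner (x - y) z = cinner x z - cinner y z" for x :: "'h::chilbert_space"
  using cinner_add_left[of x "- y" z] by (simp add: cinner_minus_left)

lemma cinner_diff_right: "cinner x (y - z) = cinner x y - cinner x z" for x :: "'h::chilbert_space"
  using cinner_add_right[of x y "- z"] by (simp add: cinner_minus_right)

lemma cinner_zero [simp]: "cinner 0 x = 0" "cinner x 0 = 0" for x :: "'h::chilbert_space"
  using cinner_diff_left[of 0 0 x] cinner_diff_right[of x 0 0] by simp_all

lemmas cinner_simps = cinner_add_left cinner_add_right cinner_diff_left cinner_diff_right
  cinner_scaleC_left cinner_scaleC_right cinner_minus_left cinner_minus_right

lemma cinner_eq_zero_iff [simp]: "cinner x x = 0 \<longleftrightarrow> x = 0" for x :: "'h::chilbert_space"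
  by (simp add: cinner_self)

lemma norm_scaleC: "norm (a *\<^sub>C x) = cmod a * norm x" for x :: "'h::chilbert_space"
proof -
  have "complex_of_real ((norm (a *\<^sub>C x))\<^sup>2) = a * cnj a * cinner x x"
    by (simp only: cinner_self[symmetric] cinner_simps mult_ac)
  also have "\<dots> = complex_of_real ((cmod a * norm x)\<^sup>2)"
    by (simp add: cinner_self complex_norm_square[symmetric] power_mult_distrib)
  finally have "(norm (a *\<^sub>C x))\<^sup>2 = (cmod a * norm x)\<^sup>2"
    using of_real_eq_iff by blast
  then show ?thesis
    by (rule power2_eq_imp_eq) auto
qed

lemma norm_add_square:
  "(norm (x + y))\<^sup>2 = (norm x)\<^sup>2 + (norm y)\<^sup>2 + 2 * Re (cinner x y)" for x :: "'h::chilbert_space"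
proof -
  have "complex_of_real ((norm (x + y))\<^sup>2)
      = of_real ((norm x)\<^sup>2) + of_real ((norm y)\<^sup>2) + (cinner x y + cnj (cinner x y))"
    unfolding cinner_self[symmetric] cinner_commute[of y x, symmetric]
    by (simp only: cinner_simps add_ac)
  also have "\<dots> = complex_of_real ((norm x)\<^sup>2 + (norm y)\<^sup>2 + 2 * Re (cinner x y))"
    by (simp add: complex_add_cnj)
  finally show ?thesis
    using of_real_eq_iff by blast
qed

lemma norm_diff_square:
  "(norm (x - y))\<^sup>2 = (norm x)\<^sup>2 + (norm y)\<^sup>2 - 2 * Re (cinner x y)" for x :: "'h::chilbert_space"
  using norm_add_square[of x "- y"] by (simp add: cinner_minus_right)

lemma Cauchy_Schwarz_cinner: "cmod (cinner x y) \<le> norm x * norm y" for x :: "'h::chilbert_space"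
proof (cases "y = 0")
  case False
  \<comment> \<open>\<open>a *\<^sub>C y\<close> is the orthogonal projection of \<open>x\<close>
    onto the line of \<open>y\<close>; the inequality expresses that the squared distance from
    \<open>x\<close> to it is nonnegative.\<close>
  define a where "a = cinner x y / of_real ((norm y)\<^sup>2)"
  have ny: "(norm y)\<^sup>2 > 0" using False by simp
  have "cinner x (a *\<^sub>C y) = of_real ((cmod (cinner x y))\<^sup>2 / (norm y)\<^sup>2)"
  proof -
    have "cinner x (a *\<^sub>C y) = (cinner x y * cnj (cinner x y)) / of_real ((norm y)\<^sup>2)"
      by (simp add: cinner_simps a_def)
    then show ?thesis by (simp only: complex_norm_square[symmetric] of_real_divide)
  qed
  moreover have "(norm (a *\<^sub>C y))\<^sup>2 = (cmod (cinner x y))\<^sup>2 / (norm y)\<^sup>2"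
    using False by (simp add: norm_scaleC a_def norm_divide power_mult_distrib power_divide
        norm_mult power2_eq_square)
  ultimately have "0 \<le> (norm x)\<^sup>2 - (cmod (cinner x y))\<^sup>2 / (norm y)\<^sup>2"
    using norm_diff_square[of x "a *\<^sub>C y"] zero_le_power2[of "norm (x - a *\<^sub>C y)"] by simp
  then have "(cmod (cinner x y))\<^sup>2 \<le> (norm x * norm y)\<^sup>2"
    using ny by (simp add: power_mult_distrib field_simps)
  then show ?thesis
    by (rule power2_le_imp_le) auto
qed simp

lemma bounded_linear_cinner_left: "bounded_linear (\<lambda>x. cinner x y)" for y :: "'h::chilbert_space"
  by (rule bounded_linear_intro[where K = "norm y"])
    (simp_all add: cinner_simps scaleR_scaleC scaleC_complex_def Cauchy_Schwarz_cinner)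

lemma bounded_linear_cinner_right: "bounded_linear (\<lambda>y. cinner x y)" for x :: "'h::chilbert_space"
  by (rule bounded_linear_intro[where K = "norm x"])
    (simp_all add: cinner_simps scaleR_scaleC scaleC_complex_def Cauchy_Schwarz_cinner
      mult.commute[of _ "norm x"])

lemmas tendsto_cinner_right = bounded_linear.tendsto[OF bounded_linear_cinner_right]

lemma cinner_sum_left: "cinner (sum f I) y = (\<Sum>i\<in>I. cinner (f i) y)" for y :: "'h::chilbert_space"
  by (rule linear_sum[OF bounded_linear.linear[OF bounded_linear_cinner_left]])

lemma cinner_sum_right: "cinner x (sum f I) = (\<Sum>i\<in>I. cinner x (f i))" for x :: "'h::chilbert_space"
  by (rule linear_sum[OF bounded_linear.linear[OF bounded_linear_cinner_right]])

lemma dense_cinner_zero: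
  fixes d :: "'h::chilbert_space"
  assumes "closure D = UNIV" and "\<And>x. x \<in> D \<Longrightarrow> cinner x d = 0"
  shows "d = 0"
proof -
  have "closed {x. cinner x d = 0}"
    by (intro closed_Collect_eq linear_continuous_on bounded_linear_cinner_left continuous_on_const)
  moreover have "D \<subseteq> {x. cinner x d = 0}" using assms(2) by auto
  ultimately have "closure D \<subseteq> {x. cinner x d = 0}" by (rule closure_minimal[rotated])
  then have "cinner d d = 0" using assms(1) by blast
  then show ?thesis by simp
qed

section \<open>Riesz representation of functionals given by graphs\<close>

lemma csubspace_pair:
  assumes "csubspace T" "(x, a) \<in> T" "(y, b) \<in> T"
  shows "(x + y, a + b) \<in> T" "(x - y, a - b) \<in> T" "(c *\<^sub>C x, c *\<^sub>C a) \<in> T"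
  using complex_vector.subspace_add[OF assms] complex_vector.subspace_diff[OF assms]
    complex_vector.subspace_scale[OF assms(1,2), of c]
  by (simp_all add: scaleC_prod_def)

text \<open>The functional is given by its graph over an arbitrary subspace and the representing vector
  is the limit of a minimizing sequence of \<open>\<parallel>x\<parallel>\<^sup>2 - 2 Re c\<close>, so neither closedness of the subspace
  nor a continuous extension is needed.\<close>

lemma Riesz_graph:
  fixes G :: "('h::chilbert_space \<times> complex) set"
  assumes G: "csubspace G" and bound: "\<And>x c. (x, c) \<in> G \<Longrightarrow> cmod c \<le> C * norm x"
  obtains h where "\<And>x c. (x, c) \<in> G \<Longrightarrow> c = cinner x h"
proof -
  define J where "J = (\<lambda>(x::'h, c). (norm x)\<^sup>2 - 2 * Re c)"
  have lower: "J p \<ge> - C\<^sup>2" if "p \<in> G" for p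
  proof -
    obtain x c where p: "p = (x, c)" by (cases p)
    have "Re c \<le> C * norm x"
      using bound[of x c] that complex_Re_le_cmod[of c] unfolding p by linarith
    moreover have "0 \<le> (norm x - C)\<^sup>2" by simp
    ultimately show ?thesis by (simp add: J_def p power2_eq_square algebra_simps)
  qed
  define m where "m = Inf (J ` G)"
  have bdd: "bdd_below (J ` G)" using lower by (intro bdd_belowI2)
  have ne: "G \<noteq> {}" using complex_vector.subspace_0[OF G] by auto
  have m: "m \<le> J p" if "p \<in> G" for p
    unfolding m_def using bdd that by (rule cINF_lower)
  have "\<exists>p\<in>G. J p < m + 1 / real (Suc n)" for n
  proof (rule ccontr)
    assume "\<not> ?thesis"
    then have "m + 1 / real (Suc n) \<le> m"
      unfolding m_def using ne by (intro cINF_greatest) (auto simp: m_def not_less)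
    then show False by simp
  qed
  then obtain p where p: "p n \<in> G" "J (p n) < m + 1 / real (Suc n)" for n by metis
  define x where "x n = fst (p n)" for n
  define c where "c n = snd (p n)" for n
  have pG: "(x n, c n) \<in> G" for n using p(1)[of n] by (simp add: x_def c_def)
  have Jp: "(norm (x n))\<^sup>2 - 2 * Re (c n) < m + 1 / real (Suc n)" for n
    using p(2)[of n] by (simp add: J_def x_def c_def split: prod.splits)
  \<comment> \<open>The linear core of the parallelogram argument: \<open>q\<close> and
    \<open>s\<close> stand for the squared norms of sum and difference, \<open>A\<close> and
    \<open>B\<close> for those of the two vectors, \<open>a\<close> and \<open>b\<close> for the
    real parts of the two functional values.\<close>
  have arith: "s \<le> 2 * u + 2 * v"
    if "4 * m \<le> q - 4 * a - 4 * b" "A - 2 * a < m + u" "B - 2 * b < m + v"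
      "q = A + B + 2 * r" "s = A + B - 2 * r" for q a b A B r s u v :: real
    using that by linarith
  \<comment> \<open>The midpoint of two members of \<open>G\<close> lies in \<open>G\<close>, so
    \<open>J\<close> is at least \<open>m\<close> there; this forces near-minimizers to be close to
    each other.\<close>
  have near: "(norm (x i - x j))\<^sup>2 \<le> 2 / real (Suc i) + 2 / real (Suc j)" for i j
  proof -
    have "((1/2) *\<^sub>C (x i + x j), (1/2) *\<^sub>C (c i + c j)) \<in> G"
      using csubspace_pair[OF G] pG by blast
    from m[OF this] have "m \<le> (norm (x i + x j))\<^sup>2 / 4 - (Re (c i) + Re (c j))"
      by (simp add: J_def norm_scaleC scaleC_complex_def power_divide add_divide_distrib)
    then have "4 * m \<le> (norm (x i + x j))\<^sup>2 - 4 * Re (c i) - 4 * Re (c j)"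
      by (simp add: field_simps)
    then have "(norm (x i - x j))\<^sup>2 \<le> 2 * (1 / real (Suc i)) + 2 * (1 / real (Suc j))"
      by (rule arith[OF _ Jp Jp norm_add_square norm_diff_square])
    then show ?thesis by simp
  qed
  have "Cauchy x"
  proof (rule metric_CauchyI)
    fix e :: real assume "e > 0"
    then obtain N where N: "4 / e\<^sup>2 < real (Suc N)" by (meson reals_Archimedean2 less_trans lessI of_nat_less_iff)
    have "dist (x i) (x j) < e" if "i \<ge> N" "j \<ge> N" for i j
    proof -
      have "2 / real (Suc i) \<le> 2 / real (Suc N)" "2 / real (Suc j) \<le> 2 / real (Suc N)"
        using that by (auto intro!: divide_left_mono)
      then have "(norm (x i - x j))\<^sup>2 \<le> 4 / real (Suc N)" using near[of i j] by simp
      also have "\<dots> < e\<^sup>2" using N \<open>e > 0\<close> by (simp add: field_simps)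
      finally show ?thesis unfolding dist_norm using \<open>e > 0\<close> by (simp add: power2_less_imp_less)
    qed
    then show "\<exists>N. \<forall>i\<ge>N. \<forall>j\<ge>N. dist (x i) (x j) < e" by blast
  qed
  then obtain h where h: "x \<longlonglongrightarrow> h" by (meson Cauchy_convergent convergentD)
  \<comment> \<open>Minimality is tested at \<open>y + x n\<close>. The values \<open>c n\<close>
    cancel in the comparison, so convergence of \<open>x\<close> alone suffices to pass to the
    limit.\<close>
  have variation: "0 \<le> 2 * Re (cinner y h - d) + (norm y)\<^sup>2" if "(y, d) \<in> G" for y d
  proof (rule LIMSEQ_le_const)
    have "(\<lambda>n. 2 * Re (cinner y (x n) - d) + (norm y)\<^sup>2 + 1 / real (Suc n))
        \<longlonglongrightarrow> 2 * Re (cinner y h - d) + (norm y)\<^sup>2 + 0"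
      by (intro tendsto_add tendsto_mult tendsto_Re tendsto_diff tendsto_const tendsto_cinner_right h
          LIMSEQ_Suc[OF lim_1_over_n])
    then show "(\<lambda>n. 2 * Re (cinner y (x n) - d) + (norm y)\<^sup>2 + 1 / real (Suc n))
        \<longlonglongrightarrow> 2 * Re (cinner y h - d) + (norm y)\<^sup>2"
      by simp
    have "0 \<le> 2 * Re (cinner y (x n) - d) + (norm y)\<^sup>2 + 1 / real (Suc n)" for n
      using m[of "(y + x n, d + c n)"] Jp[of n] csubspace_pair(1)[OF G that pG[of n]]
        norm_add_square[of y "x n"]
      by (simp add: J_def)
    then show "\<exists>N. \<forall>n\<ge>N. 0 \<le> 2 * Re (cinner y (x n) - d) + (norm y)\<^sup>2 + 1 / real (Suc n)"
      by blast
  qed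
  show ?thesis
  proof
    fix y d assume yd: "(y, d) \<in> G"
    define e where "e = cinner y h - d"
    \<comment> \<open>Along the multiple \<open>- s (cnj e)\<close> of \<open>y\<close> the linear
      term is negative of order \<open>s\<close> and the quadratic term is only of order
      \<open>s^2\<close>, so small \<open>s\<close> forces \<open>e = 0\<close>.\<close>
    have *: "0 \<le> s * (- 2 * (cmod e)\<^sup>2 + s * ((cmod e)\<^sup>2 * (norm y)\<^sup>2))" if "s > 0" for s
    proof -
      define t where "t = - (of_real s * cnj e)"
      have "0 \<le> 2 * Re (t * e) + (cmod t * norm y)\<^sup>2"
        using variation[OF csubspace_pair(3)[OF G yd yd, of t]]
        by (simp only: norm_scaleC cinner_simps scaleC_complex_def e_def right_diff_distrib)
      moreover have "Re (t * e) = - s * (cmod e)\<^sup>2"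
        by (simp add: t_def cmod_power2) (simp add: algebra_simps power2_eq_square)
      moreover have "cmod t = s * cmod e" using that by (simp add: t_def norm_mult)
      ultimately have "0 \<le> 2 * (- s * (cmod e)\<^sup>2) + (s * cmod e * norm y)\<^sup>2" by (simp only:)
      then show ?thesis by (simp only: power_mult_distrib) (simp add: algebra_simps power2_eq_square)
    qed
    have **: "2 * (cmod e)\<^sup>2 \<le> s * ((cmod e)\<^sup>2 * (norm y)\<^sup>2)" if "s > 0" for s
      using *[OF that] that by (simp add: zero_le_mult_iff)
    have "(cmod e)\<^sup>2 = 0"
    proof (rule ccontr)
      assume "(cmod e)\<^sup>2 \<noteq> 0"
      then have e: "(cmod e)\<^sup>2 > 0" by simp
      have "2 \<le> s * (norm y)\<^sup>2" if "s > 0" for s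
      proof (rule mult_right_le_imp_le[OF _ e])
        show "2 * (cmod e)\<^sup>2 \<le> s * (norm y)\<^sup>2 * (cmod e)\<^sup>2"
          using **[OF that] by (simp only: ac_simps)
      qed
      from this[of "1 / ((norm y)\<^sup>2 + 1)"]
      have "2 \<le> (norm y)\<^sup>2 / ((norm y)\<^sup>2 + 1)" by (simp add: add_nonneg_pos)
      also have "\<dots> < 1" by (simp add: add_nonneg_pos)
      finally show False by simp
    qed
    then show "d = cinner y h" by (simp add: e_def)
  qed
qed

section \<open>Adjoints and the resolvent of a self-adjoint operator\<close>

lemma adjI: "(\<And>f f'. (f, f') \<in> T \<Longrightarrow> cinner f' g = cinner f h) \<Longrightarrow> (g, h) \<in> adj T"
  by (auto simp: adj_def)

lemma adjD: "(g, h) \<in> adj T \<Longrightarrow> (f, f') \<in> T \<Longrightarrow> cinner f' g = cinner f h"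
  by (auto simp: adj_def)

lemma adj_antimono: "S \<subseteq> T \<Longrightarrow> adj T \<subseteq> adj S"
  by (auto simp: adj_def)

lemma csubspace_adj: "csubspace (adj T)"
  by (rule complex_vector.subspaceI)
    (auto simp: adj_def cinner_simps scaleC_prod_def zero_prod_def split: prod.splits)

lemma adj_single_valued:
  assumes "densely_defined T" "(g, h) \<in> adj T" "(g, h') \<in> adj T"
  shows "h = h'"
proof -
  have "h - h' = 0"
  proof (rule dense_cinner_zero)
    show "closure (Domain T) = UNIV" using assms(1) by (simp add: densely_defined_def)
    fix x assume "x \<in> Domain T"
    then obtain x' where "(x, x') \<in> T" by auto
    then show "cinner x (h - h') = 0"
      using adjD[OF assms(2), of x x'] adjD[OF assms(3), of x x'] by (simp add: cinner_simps)
  qed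
  then show ?thesis by simp
qed

lemma self_adjointD:
  assumes "self_adjoint S"
  shows "csubspace S" "adj S = S" "closure (Domain S) = UNIV"
    and "(f, f') \<in> S \<Longrightarrow> (g, g') \<in> S \<Longrightarrow> cinner f' g = cinner f g'"
  using assms adjD[of g g' S f f'] by (auto simp: self_adjoint_def linear_operator_def densely_defined_def)

lemma self_adjoint_real_form:
  assumes "self_adjoint S" "(f, f') \<in> S"
  shows "Im (cinner f' f) = 0"
proof -
  have "cinner f' f = cnj (cinner f' f)"
    using self_adjointD(4)[OF assms(1) assms(2) assms(2)] cinner_commute[of f f'] by simp
  then show ?thesis by (simp add: complex_eq_iff)
qed

lemma self_adjoint_no_eigenvalue:
  assumes "self_adjoint S" "(f, z *\<^sub>C f) \<in> S" "Im z \<noteq> 0"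
  shows "f = 0"
  using self_adjoint_real_form[OF assms(1,2)] assms(3) by (simp add: cinner_simps cinner_self)

text \<open>Since \<open>cinner f' f\<close> is real, pairing \<open>f' - z f\<close> with
  \<open>f\<close> has imaginary part \<open>- Im z (norm f)^2\<close>; Cauchy-Schwarz does the
  rest.\<close>

lemma self_adjoint_lower_bound:
  assumes "self_adjoint S" "(f, f') \<in> S"
  shows "\<bar>Im z\<bar> * norm f \<le> norm (f' - z *\<^sub>C f)"
proof (cases "f = 0")
  case False
  have "Im (cinner (f' - z *\<^sub>C f) f) = - Im z * (norm f)\<^sup>2"
    using self_adjoint_real_form[OF assms] by (simp add: cinner_simps cinner_self)
  then have "\<bar>Im z\<bar> * (norm f)\<^sup>2 \<le> cmod (cinner (f' - z *\<^sub>C f) f)"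
    using abs_Im_le_cmod[of "cinner (f' - z *\<^sub>C f) f"] by (simp add: abs_mult)
  also have "\<dots> \<le> norm (f' - z *\<^sub>C f) * norm f" by (rule Cauchy_Schwarz_cinner)
  finally have "(\<bar>Im z\<bar> * norm f) * norm f \<le> norm (f' - z *\<^sub>C f) * norm f"
    by (simp add: power2_eq_square mult.assoc)
  then show ?thesis using False by (metis mult_right_le_imp_le zero_less_norm_iff)
qed simp

text \<open>By duality: the lower bound for \<open>cnj z\<close> makes the functional sending
  \<open>(S - cnj z) f\<close> to \<open>cinner f k\<close> bounded. Its Riesz vector
  \<open>h\<close> then lies in the domain of the adjoint, which is \<open>S\<close>, and
  \<open>(S - z) h = k\<close>.\<close>

lemma self_adjoint_surj:
  assumes S: "self_adjoint S" and z: "Im z \<noteq> 0"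
  obtains f f' where "(f, f') \<in> S" "f' - z *\<^sub>C f = k"
proof -
  define G where "G = (\<lambda>(f, f'). (f' - cnj z *\<^sub>C f, cinner f k)) ` S"
  have "csubspace G"
  proof (rule complex_vector.subspaceI)
    show "0 \<in> G"
      unfolding G_def using complex_vector.subspace_0[OF self_adjointD(1)[OF S]]
      by (force simp: zero_prod_def image_iff)
    show "a + b \<in> G" if "a \<in> G" "b \<in> G" for a b
    proof -
      from that obtain f f' g g' where
        "(f, f') \<in> S" "a = (f' - cnj z *\<^sub>C f, cinner f k)"
        "(g, g') \<in> S" "b = (g' - cnj z *\<^sub>C g, cinner g k)"
        by (auto simp: G_def)
      then show ?thesis
        unfolding G_def using csubspace_pair(1)[OF self_adjointD(1)[OF S], of f f' g g']
        by (intro image_eqI[of _ _ "(f + g, f' + g')"]) (auto simp: scaleC_simps cinner_simps)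
    qed
    show "c *\<^sub>C a \<in> G" if "a \<in> G" for c a
    proof -
      from that obtain f f' where
        "(f, f') \<in> S" "a = (f' - cnj z *\<^sub>C f, cinner f k)"
        by (auto simp: G_def)
      then show ?thesis
        unfolding G_def using csubspace_pair(3)[OF self_adjointD(1)[OF S], of f f' f f' c]
        by (intro image_eqI[of _ _ "(c *\<^sub>C f, c *\<^sub>C f')"])
          (auto simp: scaleC_simps cinner_simps scaleC_prod_def scaleC_complex_def mult.commute
            complex_vector.scale_right_diff_distrib)
    qed
  qed
  moreover have "cmod c \<le> (norm k / \<bar>Im z\<bar>) * norm x" if "(x, c) \<in> G" for x c
  proof -
    from that obtain f f' where f: "(f, f') \<in> S" "x = f' - cnj z *\<^sub>C f" "c = cinner f k"
      by (auto simp: G_def)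
    have "norm f \<le> norm x / \<bar>Im z\<bar>"
      using self_adjoint_lower_bound[OF S f(1), of "cnj z"] z unfolding f(2)[symmetric] by (simp add: field_simps)
    then have "norm f * norm k \<le> norm x / \<bar>Im z\<bar> * norm k" by (rule mult_right_mono) simp
    then show ?thesis
      using Cauchy_Schwarz_cinner[of f k] f(3) by (simp add: mult.commute)
  qed
  ultimately obtain h where h: "\<And>x c. (x, c) \<in> G \<Longrightarrow> c = cinner x h"
    using Riesz_graph by blast
  have "(h, k + z *\<^sub>C h) \<in> adj S"
  proof (rule adjI)
    fix f f' assume "(f, f') \<in> S"
    then have "(f' - cnj z *\<^sub>C f, cinner f k) \<in> G" by (force simp: G_def)
    from h[OF this] show "cinner f' h = cinner f (k + z *\<^sub>C h)" by (simp add: cinner_simps)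
  qed
  then show ?thesis
    using that[of h "k + z *\<^sub>C h"] self_adjointD(2)[OF S] by simp
qed

section \<open>The spectral measure of a stationary sequence\<close>

text \<open>Orthogonality of the characters over one period; it singles out the terms with a fixed
  index difference in the Fejer sums below.\<close>

lemma has_bochner_integral_cis_period:
  fixes m :: int
  shows "has_bochner_integral lborel (\<lambda>s. indicator {0..2 * pi} s *\<^sub>R cis (m * s))
    (if m = 0 then of_real (2 * pi) else 0)"
proof -
  have cont: "continuous_on {0..2 * pi} (\<lambda>s. cis (m * s))"
    by (intro continuous_intros)
  show ?thesis
  proof (cases "m = 0")
    case True
    have "has_bochner_integral lborel (\<lambda>s. indicator {0..2 * pi} s *\<^sub>R cis (m * s))
        (of_real (2 * pi) - of_real 0)"
      using True by (intro has_bochner_integral_FTC_Icc cont) (auto intro!: derivative_eq_intros)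
    then show ?thesis using True by simp
  next
    case False
    have "((\<lambda>s. cis (m * s) / (\<i> * of_int m)) has_vector_derivative cis (m * s)) (at s within {0..2 * pi})"
      for s :: real
    proof -
      have "((\<lambda>s. exp (\<i> * of_int m * of_real s) / (\<i> * of_int m)) has_vector_derivative
          exp (\<i> * of_int m * of_real s)) (at s within {0..2 * pi})"
        using False by (auto intro!: derivative_eq_intros has_vector_derivative_real_field)
      then show ?thesis by (simp add: cis_conv_exp mult_ac)
    qed
    then have "has_bochner_integral lborel (\<lambda>s. indicator {0..2 * pi} s *\<^sub>R cis (m * s))
        (cis (m * (2 * pi)) / (\<i> * of_int m) - cis (m * (0::real)) / (\<i> * of_int m))"
      by (intro has_bochner_integral_FTC_Icc cont) auto
    moreover have "cis (m * (2 * pi)) = 1"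
      using cis_multiple_2pi[of "of_int m"] by (simp add: mult_ac)
    ultimately show ?thesis using False by simp
  qed
qed

lemma isCont_cis: "isCont (\<lambda>s. cis (a * s)) x"
proof -
  have "continuous_on UNIV (\<lambda>s. cis (a * s))" by (intro continuous_intros)
  then show ?thesis by (simp add: continuous_on_eq_continuous_at)
qed

text \<open>Herglotz' theorem: the measure is a weak limit of the Fejer means of the sequence of moments,
  which are nonnegative because they are squared norms.\<close>

lemma stationary_sequence_spectral_measure:
  fixes x :: "nat \<Rightarrow> 'h::chilbert_space"
  assumes stationary: "\<And>j k. cinner (x (Suc j)) (x (Suc k)) = cinner (x j) (x k)"
    and norm: "norm (x 0) = 1"
  obtains \<nu> :: "real measure" where "real_distribution \<nu>"
    and "\<And>n. (\<integral>s. cis (real n * s) \<partial>\<nu>) = cinner (x n) (x 0)"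
proof -
  define c where "c n = cinner (x n) (x 0)" for n
  have shift: "cinner (x (k + n)) (x k) = c n" for n k
    by (induction k) (simp_all add: c_def stationary)
  \<comment> \<open>The Fejer mean of order \<open>N\<close>, written as a squared norm so that
    nonnegativity is immediate; \<open>D_eq\<close> expands it as a trigonometric
    polynomial.\<close>
  define D where "D N s = (norm (\<Sum>k<N. cis (- (real k * s)) *\<^sub>C x k))\<^sup>2 / (2 * pi * real N)" for N s
  have D_eq: "of_real (D N s) * cis (real n * s) =
      (\<Sum>j<N. \<Sum>k<N. cinner (x j) (x k) / of_real (2 * pi * real N) * cis (of_int (int k + int n - int j) * s))"
    for N n s
  proof -
    have "complex_of_real ((norm (\<Sum>k<N. cis (- (real k * s)) *\<^sub>C x k))\<^sup>2)
        = (\<Sum>j<N. \<Sum>k<N. cis (- (real j * s)) * (cnj (cis (- (real k * s))) * cinner (x j) (x k)))"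
      by (simp only: cinner_self[symmetric])
        (simp add: cinner_sum_left cinner_sum_right cinner_simps sum_distrib_left,
          subst sum.swap, simp add: mult_ac)
    then have "of_real (D N s) * cis (real n * s) =
        (\<Sum>j<N. \<Sum>k<N. cinner (x j) (x k) / of_real (2 * pi * real N) *
          (cis (- (real j * s)) * cnj (cis (- (real k * s))) * cis (real n * s)))"
      by (simp add: D_def sum_distrib_left sum_distrib_right sum_divide_distrib mult_ac del: of_real_mult)
    also have "\<dots> = (\<Sum>j<N. \<Sum>k<N. cinner (x j) (x k) / of_real (2 * pi * real N) *
        cis (of_int (int k + int n - int j) * s))"
      by (intro sum.cong refl) (simp add: cis_cnj cis_mult algebra_simps)
    finally show ?thesis .
  qed
  have D_nonneg: "0 \<le> D N s" for N s by (simp add: D_def)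
  have D_measurable [measurable]: "D N \<in> borel_measurable borel" for N
  proof -
    have "continuous_on UNIV (\<lambda>s. Re (of_real (D N s) * cis (real 0 * s)))"
      unfolding D_eq by (intro continuous_intros)
    then have "continuous_on UNIV (D N)" by simp
    then show ?thesis by (rule borel_measurable_continuous_onI)
  qed
  \<comment> \<open>\<open>N - n\<close> counts the pairs \<open>j = k + n\<close> with both indices
    below \<open>N\<close>; the truncated subtraction gives \<open>0\<close> for
    \<open>n \<ge> N\<close>, as it should.\<close>
  have moment: "has_bochner_integral lborel (\<lambda>s. (indicator {0..2 * pi} s * D N s) *\<^sub>R cis (real n * s))
      (of_nat (N - n) / of_nat N * c n)" if "N > 0" for N n
  proof -
    have "has_bochner_integral lborel
        (\<lambda>s. \<Sum>j<N. \<Sum>k<N. cinner (x j) (x k) / of_real (2 * pi * real N) *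
          (indicator {0..2 * pi} s *\<^sub>R cis (of_int (int k + int n - int j) * s)))
        (\<Sum>j<N. \<Sum>k<N. cinner (x j) (x k) / of_real (2 * pi * real N) *
          (if int k + int n - int j = 0 then of_real (2 * pi) else 0))"
      by (intro has_bochner_integral_sum has_bochner_integral_mult_right has_bochner_integral_cis_period)
    moreover have "(\<lambda>s. \<Sum>j<N. \<Sum>k<N. cinner (x j) (x k) / of_real (2 * pi * real N) *
          (indicator {0..2 * pi} s *\<^sub>R cis (of_int (int k + int n - int j) * s)))
        = (\<lambda>s. (indicator {0..2 * pi} s * D N s) *\<^sub>R cis (real n * s))"
    proof
      fix s
      have "(indicator {0..2 * pi} s * D N s) *\<^sub>R cis (real n * s)
          = indicator {0..2 * pi} s *\<^sub>R (of_real (D N s) * cis (real n * s))"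
        by (simp add: scaleR_conv_of_real)
      then show "(\<Sum>j<N. \<Sum>k<N. cinner (x j) (x k) / of_real (2 * pi * real N) *
          (indicator {0..2 * pi} s *\<^sub>R cis (of_int (int k + int n - int j) * s)))
        = (indicator {0..2 * pi} s * D N s) *\<^sub>R cis (real n * s)"
        unfolding D_eq by (simp add: scaleR_sum_right)
    qed
    moreover have "(\<Sum>j<N. \<Sum>k<N. cinner (x j) (x k) / of_real (2 * pi * real N) *
          (if int k + int n - int j = 0 then of_real (2 * pi) else 0)) = of_nat (N - n) / of_nat N * c n"
    proof -
      have "(\<Sum>j<N. \<Sum>k<N. cinner (x j) (x k) / of_real (2 * pi * real N) *
          (if int k + int n - int j = 0 then of_real (2 * pi) else 0))
        = (\<Sum>k<N. \<Sum>j<N. if j = k + n then c n / of_nat N else 0)"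
        by (subst sum.swap, intro sum.cong refl) (auto simp: shift)
      also have "\<dots> = (\<Sum>k<N. if k + n < N then c n / of_nat N else 0)"
        by (intro sum.cong refl) simp
      also have "\<dots> = (\<Sum>k\<in>{..<N - n}. c n / of_nat N)"
        by (rule sum.mono_neutral_cong_right) auto
      finally show ?thesis by simp
    qed
    ultimately show ?thesis by simp
  qed
  \<comment> \<open>The shift to \<open>Suc i\<close> excludes the degenerate mean of order
    \<open>0\<close>.\<close>
  define \<mu> where "\<mu> i = density lborel (\<lambda>s. ennreal (indicator {0..2 * pi} s * D (Suc i) s))" for i
  have total: "(\<integral>\<^sup>+s. ennreal (indicator {0..2 * pi} s * D (Suc i) s) \<partial>lborel) = 1" for i
  proof -
    have "has_bochner_integral lborel (\<lambda>s. Re ((indicator {0..2 * pi} s * D (Suc i) s) *\<^sub>R cis (real 0 * s)))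
        (Re (of_nat (Suc i - 0) / of_nat (Suc i) * c 0))"
      by (intro has_bochner_integral_Re moment) simp
    then have "has_bochner_integral lborel (\<lambda>s. indicator {0..2 * pi} s * D (Suc i) s) 1"
      by (simp add: c_def cinner_self norm del: of_nat_Suc)
    then show ?thesis
      by (subst nn_integral_eq_integral) (auto simp: has_bochner_integral_iff D_nonneg)
  qed
  have mu_dist: "real_distribution (\<mu> i)" for i
    unfolding real_distribution_def real_distribution_axioms_def
    by (auto simp: \<mu>_def emeasure_density total intro!: prob_spaceI)
  have mu_moment: "(\<integral>s. cis (real n * s) \<partial>\<mu> i) = of_nat (Suc i - n) / of_nat (Suc i) * c n" for i n
  proof -
    have "has_bochner_integral (\<mu> i) (\<lambda>s. cis (real n * s)) (of_nat (Suc i - n) / of_nat (Suc i) * c n)"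
      unfolding \<mu>_def by (intro has_bochner_integral_density moment)
        (auto simp: D_nonneg intro!: borel_measurable_continuous_onI continuous_intros)
    then show ?thesis by (rule has_bochner_integral_integral_eq)
  qed
  have "tight \<mu>"
    unfolding tight_def
  proof (intro conjI allI impI mu_dist)
    fix \<epsilon> :: real assume "\<epsilon> > 0"
    \<comment> \<open>Tightness is phrased with intervals open on the left, so the left end
      \<open>-1\<close> keeps the point \<open>0\<close> of the period inside.\<close>
    have "emeasure (\<mu> i) {-1<..2 * pi} = 1" for i
      unfolding \<mu>_def total[of i, symmetric]
      by (subst emeasure_density) (auto intro!: nn_integral_cong split: split_indicator)
    then have "measure (\<mu> i) {-1<..2 * pi} > 1 - \<epsilon>" for i
      using \<open>\<epsilon> > 0\<close> by (simp add: measure_def)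
    moreover have "-1 < 2 * pi" using pi_gt_zero by linarith
    ultimately show "\<exists>a b. a < b \<and> (\<forall>n. 1 - \<epsilon> < measure (\<mu> n) {a<..b})" by blast
  qed
  then obtain r \<nu> where r: "strict_mono (r :: nat \<Rightarrow> nat)" and \<nu>: "real_distribution \<nu>"
    and weak: "weak_conv_m (\<mu> \<circ> id \<circ> r) \<nu>"
    using tight_imp_convergent_subsubsequence[of \<mu> id] strict_mono_id by blast
  \<comment> \<open>The characters are bounded and continuous, so their integrals pass to the weak
    limit, while the Fejer weights tend to \<open>1\<close>.\<close>
  have "(\<integral>s. cis (real n * s) \<partial>\<nu>) = c n" for n
  proof (rule LIMSEQ_unique)
    show "(\<lambda>i. \<integral>s. cis (real n * s) \<partial>(\<mu> \<circ> id \<circ> r) i) \<longlonglongrightarrow> (\<integral>s. cis (real n * s) \<partial>\<nu>)"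
      by (rule weak_conv_imp_integral_bdd_continuous_conv[OF _ \<nu> weak, where B = 1])
        (auto simp: mu_dist isCont_cis)
    have lim: "(\<lambda>i. real (Suc i - n) / real (Suc i)) \<longlonglongrightarrow> 1"
      by real_asymp
    have "(\<lambda>i. complex_of_real (real (Suc i - n) / real (Suc i)) * c n) \<longlonglongrightarrow> of_real 1 * c n"
      by (intro tendsto_intros lim)
    from LIMSEQ_subseq_LIMSEQ[OF this r]
    show "(\<lambda>i. \<integral>s. cis (real n * s) \<partial>(\<mu> \<circ> id \<circ> r) i) \<longlonglongrightarrow> c n"
      by (simp add: mu_moment o_def del: of_nat_Suc)
  qed
  then show ?thesis using that \<nu> by (simp add: c_def)
qed

text \<open>\<open>S - \<i>\<close> is onto and injective, so
  \<open>W = (S + \<i>)(S - \<i>)^-1\<close> is defined everywhere. It is isometric because symmetry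
  of \<open>S\<close> cancels the cross terms of \<open>S f \<plusminus> \<i> f\<close>.\<close>

lemma cayley_transform:
  fixes S :: "('h::chilbert_space \<times> 'h) set"
  assumes S: "self_adjoint S"
  obtains W where "\<And>f f'. (f, f') \<in> S \<Longrightarrow> W (f' - \<i> *\<^sub>C f) = f' + \<i> *\<^sub>C f"
    and "\<And>x y. W (x + y) = W x + W y" and "\<And>c x. W (c *\<^sub>C x) = c *\<^sub>C W x"
    and "\<And>x y. cinner (W x) (W y) = cinner x y"
proof -
  have "\<exists>f f'. (f, f') \<in> S \<and> f' - \<i> *\<^sub>C f = h" for h
    by (rule self_adjoint_surj[OF S, of \<i> h]) auto
  then obtain u u' where u: "(u h, u' h) \<in> S" "u' h - \<i> *\<^sub>C u h = h" for h by metis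
  define W where "W h = u' h + \<i> *\<^sub>C u h" for h
  have W: "W (f' - \<i> *\<^sub>C f) = f' + \<i> *\<^sub>C f" if f: "(f, f') \<in> S" for f f'
  proof -
    define h where "h = f' - \<i> *\<^sub>C f"
    have "(u h - f, u' h - f') \<in> S"
      using csubspace_pair(2)[OF self_adjointD(1)[OF S] u(1) f] .
    moreover have "u' h - f' = \<i> *\<^sub>C (u h - f)"
      using u(2)[of h] by (simp add: h_def complex_vector.scale_right_diff_distrib algebra_simps)
    ultimately have "u h = f" using self_adjoint_no_eigenvalue[OF S, of "u h - f" \<i>] by simp
    moreover from this have "u' h = f'" using u(2)[of h] by (simp add: h_def)
    ultimately show ?thesis by (simp add: W_def h_def)
  qed
  show ?thesis
  proof
    fix x y :: 'h and c
    show "W (x + y) = W x + W y"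
      using W[OF csubspace_pair(1)[OF self_adjointD(1)[OF S] u(1)[of x] u(1)[of y]]] u(2)[of x] u(2)[of y]
      by (simp add: W_def scaleC_add_right algebra_simps)
    show "W (c *\<^sub>C x) = c *\<^sub>C W x"
      using W[OF csubspace_pair(3)[OF self_adjointD(1)[OF S] u(1)[of x] u(1)[of x], of c]] u(2)[of x]
      by (metis W_def complex_vector.scale_left_commute complex_vector.scale_right_diff_distrib
          scaleC_add_right)
    show "cinner (W x) (W y) = cinner x y"
    proof -
      have "cinner (W x) (W y) = cinner (u' x - \<i> *\<^sub>C u x) (u' y - \<i> *\<^sub>C u y)"
        using self_adjointD(4)[OF S u(1)[of x] u(1)[of y]]
        by (simp add: W_def cinner_simps algebra_simps)
      then show ?thesis by (simp add: u(2))
    qed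
  qed (rule W)
qed

section \<open>Powers of an isometry: Neumann series and ergodic means\<close>

locale linear_isometry =
  fixes W :: "'h::chilbert_space \<Rightarrow> 'h"
  assumes add: "W (x + y) = W x + W y" and scale: "W (c *\<^sub>C x) = c *\<^sub>C W x"
    and isometry: "cinner (W x) (W y) = cinner x y"
begin

lemma pow_add: "(W ^^ n) (x + y) = (W ^^ n) x + (W ^^ n) y"
  by (induction n) (simp_all add: add)

lemma pow_scale: "(W ^^ n) (c *\<^sub>C x) = c *\<^sub>C (W ^^ n) x"
  by (induction n) (simp_all add: scale)

lemma pow_diff: "(W ^^ n) (x - y) = (W ^^ n) x - (W ^^ n) y"
  using pow_add[of n x "(-1) *\<^sub>C y"] pow_scale[of n "-1" y] by (simp add: scaleC_minus_one)

lemma pow_isometry: "cinner ((W ^^ n) x) ((W ^^ n) y) = cinner x y"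
  by (induction n) (simp_all add: isometry)

lemma norm_pow: "norm ((W ^^ n) x) = norm x"
proof -
  have "complex_of_real ((norm ((W ^^ n) x))\<^sup>2) = complex_of_real ((norm x)\<^sup>2)"
    using pow_isometry[of n x x] by (simp only: cinner_self)
  then have "(norm ((W ^^ n) x))\<^sup>2 = (norm x)\<^sup>2" using of_real_eq_iff by blast
  then show ?thesis by (rule power2_eq_imp_eq) auto
qed

text \<open>Neumann series of \<open>(1 - w W)^-1\<close>: substituting \<open>g = F - w W F\<close>
  makes the partial sums telescope, and the remainder is of size \<open>(cmod w)^N\<close> since
  \<open>W\<close> preserves norms.\<close>

lemma resolvent_sums:
  assumes "F - w *\<^sub>C W F = g" and "cmod w < 1"
  shows "(\<lambda>n. w ^ n * cinner ((W ^^ n) g) k) sums cinner F k"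
proof -
  have step: "(W ^^ n) g = (W ^^ n) F - w *\<^sub>C (W ^^ Suc n) F" for n
    by (simp add: assms(1)[symmetric] pow_diff pow_scale funpow_swap1)
  have "(\<Sum>n<N. w ^ n * cinner ((W ^^ n) g) k) = cinner F k - w ^ N * cinner ((W ^^ N) F) k" for N
  proof (induction N)
    case (Suc N)
    then show ?case by (simp add: step cinner_simps algebra_simps del: funpow.simps)
  qed simp
  moreover have "(\<lambda>N. w ^ N * cinner ((W ^^ N) F) k) \<longlonglongrightarrow> 0"
  proof (rule Lim_null_comparison)
    show "\<forall>\<^sub>F N in sequentially. norm (w ^ N * cinner ((W ^^ N) F) k) \<le> cmod w ^ N * (norm F * norm k)"
      using Cauchy_Schwarz_cinner[of "(W ^^ _) F" k]
      by (intro always_eventually allI) (auto simp: norm_mult norm_power norm_pow intro!: mult_left_mono)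
    show "(\<lambda>N. cmod w ^ N * (norm F * norm k)) \<longlonglongrightarrow> 0"
      using assms(2) by (intro tendsto_mult_left_zero LIMSEQ_power_zero) simp
  qed
  ultimately show ?thesis
    unfolding sums_def using tendsto_diff[OF tendsto_const, of _ 0 sequentially "cinner F k"] by simp
qed

text \<open>For \<open>g = W h - h\<close> the sums telescope and stay bounded, so the averages
  vanish in the limit; density reduces the general case to this one because powers of
  \<open>W\<close> do not enlarge the error.\<close>

lemma mean_ergodic_zero:
  assumes dense: "closure {W h - h | h. True} = UNIV"
  shows "(\<lambda>N. (\<Sum>n<N. cinner ((W ^^ n) g) k) / of_nat N) \<longlonglongrightarrow> 0"
proof (rule LIMSEQ_I)
  fix r :: real assume "r > 0"
  \<comment> \<open>Adding \<open>1\<close> keeps the divisor in \<open>e\<close> positive when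
    \<open>k = 0\<close>.\<close>
  define b where "b = norm k + 1"
  define e where "e = r / (2 * b)"
  have "b > 0" by (simp add: b_def add_nonneg_pos)
  then have "e > 0" "e * b = r / 2" using \<open>r > 0\<close> by (simp_all add: e_def)
  then have e: "e > 0" "e * norm k < r / 2" by (auto simp: b_def distrib_left)
  obtain h where h: "dist (W h - h) g < e"
    using dense e(1) closure_approachable[of g "{W h - h | h. True}"] by auto
  have tele: "(\<Sum>n<N. (W ^^ n) (W h - h)) = (W ^^ N) h - h" for N
    by (induction N) (simp_all add: pow_diff funpow_swap1)
  have "norm ((\<Sum>n<N. cinner ((W ^^ n) g) k) / of_nat N) < r"
    if N: "real N > 4 * (norm h * norm k) / r" for N
  proof -
    have "4 * (norm h * norm k) / r \<ge> 0" using \<open>r > 0\<close> by simp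
    then have N0: "N > 0" using N by linarith
    have "(\<Sum>n<N. (W ^^ n) g) = (\<Sum>n<N. (W ^^ n) (g - (W h - h))) + ((W ^^ N) h - h)"
      unfolding tele[symmetric] sum.distrib[symmetric] pow_add[symmetric] by simp
    then have "norm (\<Sum>n<N. (W ^^ n) g)
        \<le> norm (\<Sum>n<N. (W ^^ n) (g - (W h - h))) + norm ((W ^^ N) h - h)"
      by (simp add: norm_triangle_ineq)
    also have "norm (\<Sum>n<N. (W ^^ n) (g - (W h - h))) \<le> (\<Sum>n<N. e)"
      using h by (intro sum_norm_le) (simp add: norm_pow dist_norm norm_minus_commute less_imp_le)
    also have "norm ((W ^^ N) h - h) \<le> 2 * norm h"
      using norm_triangle_ineq4[of "(W ^^ N) h" h] by (simp add: norm_pow)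
    finally have "norm (\<Sum>n<N. (W ^^ n) g) \<le> real N * e + 2 * norm h" by simp
    then have "norm (\<Sum>n<N. (W ^^ n) g) * norm k \<le> (real N * e + 2 * norm h) * norm k"
      by (rule mult_right_mono) simp
    then have "cmod (cinner (\<Sum>n<N. (W ^^ n) g) k) \<le> real N * (e * norm k) + 2 * (norm h * norm k)"
      using Cauchy_Schwarz_cinner[of "\<Sum>n<N. (W ^^ n) g" k] by (simp add: algebra_simps)
    also have "\<dots> < real N * (r / 2) + real N * (r / 2)"
      using N N0 e(2) \<open>r > 0\<close> by (intro add_strict_mono) (auto simp: field_simps)
    finally show ?thesis using N0 by (simp add: cinner_sum_left norm_divide field_simps)
  qed
  moreover obtain N0 where "real N0 > 4 * (norm h * norm k) / r" using reals_Archimedean2 by blast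
  ultimately show "\<exists>M. \<forall>N\<ge>M. norm ((\<Sum>n<N. cinner ((W ^^ n) g) k) / of_nat N - 0) < r"
    by (intro exI[of _ N0]) (force intro: less_le_trans)
qed

end

section \<open>Moments of a measure on the circle\<close>

lemma power_of_cis: "cis (real n * s) = cis s ^ n"
  using Complex.DeMoivre[of s n] by simp

lemma measurable_cis_mult [measurable]: "(\<lambda>s. cis (real n * s)) \<in> borel_measurable borel"
  by (intro borel_measurable_continuous_onI continuous_intros)

lemma measurable_cis [measurable]: "cis \<in> borel_measurable borel"
  by (intro borel_measurable_continuous_onI continuous_intros)

text \<open>The averages of \<open>cis (n s)\<close> are bounded by \<open>1\<close> and converge
  pointwise to the indicator of \<open>cis s = 1\<close>, so the averaged moments converge to the
  mass of that set.\<close>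

lemma AE_cis_neq_1:
  fixes \<nu> :: "real measure"
  assumes \<nu>: "real_distribution \<nu>"
    and mean: "(\<lambda>N. (\<Sum>n<N. \<integral>s. cis (real n * s) \<partial>\<nu>) / of_nat N) \<longlonglongrightarrow> 0"
  shows "AE s in \<nu>. cis s \<noteq> 1"
proof -
  interpret real_distribution \<nu> by fact
  have int: "integrable \<nu> (\<lambda>s. cis (real n * s))" for n
    by (rule integrable_const_bound[where B = 1]) auto
  have "(\<lambda>N. (\<Sum>n<N. cis (real n * s)) / of_nat N) \<longlonglongrightarrow> indicator {s. cis s = 1} s" for s
  proof (cases "cis s = 1")
    case True
    have "\<forall>\<^sub>F N in sequentially. (\<Sum>n<N. cis (real n * s)) / of_nat N = 1"
      using eventually_gt_at_top[of 0] by eventually_elim (simp add: power_of_cis True)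
    then show ?thesis using True by (simp add: tendsto_eventually)
  next
    case False
    have "(\<lambda>N. (\<Sum>n<N. cis (real n * s)) / of_nat N) \<longlonglongrightarrow> 0"
    proof (rule Lim_null_comparison)
      show "\<forall>\<^sub>F N in sequentially. norm ((\<Sum>n<N. cis (real n * s)) / of_nat N)
          \<le> 2 / cmod (1 - cis s) * (1 / real N)"
      proof (intro always_eventually allI)
        fix N
        have "cmod (\<Sum>n<N. cis (real n * s)) = cmod (1 - cis s ^ N) / cmod (1 - cis s)"
          using False by (simp add: power_of_cis sum_gp_strict norm_divide)
        also have "\<dots> \<le> 2 / cmod (1 - cis s)"
          using norm_triangle_ineq4[of 1 "cis s ^ N"] by (intro divide_right_mono) (simp_all add: norm_power)
        finally have "cmod (\<Sum>n<N. cis (real n * s)) / real N \<le> 2 / cmod (1 - cis s) / real N"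
          by (rule divide_right_mono) simp
        then show "norm ((\<Sum>n<N. cis (real n * s)) / of_nat N) \<le> 2 / cmod (1 - cis s) * (1 / real N)"
          by (simp add: norm_divide)
      qed
      show "(\<lambda>N. 2 / cmod (1 - cis s) * (1 / real N)) \<longlonglongrightarrow> 0"
        by (intro tendsto_mult_right_zero lim_1_over_n)
    qed
    then show ?thesis using False by simp
  qed
  then have "(\<lambda>N. \<integral>s. (\<Sum>n<N. cis (real n * s)) / of_nat N \<partial>\<nu>)
      \<longlonglongrightarrow> (\<integral>s. indicator {s. cis s = 1} s \<partial>\<nu>)"
  proof (intro integral_dominated_convergence[where w = "\<lambda>_. 1"])
    show "AE s in \<nu>. norm ((\<Sum>n<N. cis (real n * s)) / of_nat N) \<le> 1" for N
    proof (intro AE_I2)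
      fix s
      have "cmod (\<Sum>n<N. cis (real n * s)) \<le> (\<Sum>n<N. 1)" by (intro sum_norm_le) simp
      then show "norm ((\<Sum>n<N. cis (real n * s)) / of_nat N) \<le> 1"
        by (cases "N = 0") (simp_all add: norm_divide)
    qed
  qed auto
  moreover have "(\<integral>s. (\<Sum>n<N. cis (real n * s)) / of_nat N \<partial>\<nu>)
      = (\<Sum>n<N. \<integral>s. cis (real n * s) \<partial>\<nu>) / of_nat N" for N
    using int by (simp add: Bochner_Integration.integral_sum)
  ultimately have "(\<lambda>N. (\<Sum>n<N. \<integral>s. cis (real n * s) \<partial>\<nu>) / of_nat N)
      \<longlonglongrightarrow> (\<integral>s. indicator {s. cis s = 1} s \<partial>\<nu>)"
    by (simp only:)
  then have "(\<integral>s. indicator {s. cis s = 1} s \<partial>\<nu>) = (0 :: complex)"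
    using mean by (rule LIMSEQ_unique)
  then have "complex_of_real (\<integral>s. indicator {s. cis s = 1} s \<partial>\<nu>) = 0"
    by (subst integral_complex_of_real[symmetric]) (simp add: of_real_indicator)
  then have "measure \<nu> {s. cis s = 1} = 0" by simp
  then show ?thesis
    by (subst AE_iff_measurable[where N = "{s. cis s = 1}"]) (auto simp: emeasure_eq_measure)
qed

text \<open>The geometric series may be integrated termwise because its terms have modulus
  \<open>(cmod w)^n\<close> and the measure has mass \<open>1\<close>.\<close>

lemma integral_geometric_cis:
  fixes \<nu> :: "real measure"
  assumes \<nu>: "real_distribution \<nu>" and w: "cmod w < 1"
  shows "integrable \<nu> (\<lambda>s. 1 / (1 - w * cis s))"
    and "(\<integral>s. 1 / (1 - w * cis s) \<partial>\<nu>) = (\<Sum>n. w ^ n * (\<integral>s. cis (real n * s) \<partial>\<nu>))"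
proof -
  interpret real_distribution \<nu> by fact
  have geom: "1 / (1 - w * cis s) = (\<Sum>n. w ^ n * cis (real n * s))" for s
    using suminf_geometric[of "w * cis s"] w
    by (simp add: norm_mult power_mult_distrib power_of_cis)
  have int: "integrable \<nu> (\<lambda>s. w ^ n * cis (real n * s))" for n
    by (rule integrable_const_bound[where B = "cmod w ^ n"]) (auto simp: norm_mult norm_power)
  have norms: "summable (\<lambda>n. norm (w ^ n * cis (real n * s)))" for s
    using w by (simp add: norm_mult norm_power)
  have "(\<integral>s. norm (w ^ n * cis (real n * s)) \<partial>\<nu>) = cmod w ^ n" for n
    using prob_space by (simp add: norm_mult norm_power)
  then have sums: "summable (\<lambda>n. \<integral>s. norm (w ^ n * cis (real n * s)) \<partial>\<nu>)"
    using w by simp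
  show "integrable \<nu> (\<lambda>s. 1 / (1 - w * cis s))"
    unfolding geom by (intro integrable_suminf int sums AE_I2 norms)
  have "(\<integral>s. 1 / (1 - w * cis s) \<partial>\<nu>) = (\<Sum>n. \<integral>s. w ^ n * cis (real n * s) \<partial>\<nu>)"
    unfolding geom by (intro integral_suminf int sums AE_I2 norms)
  then show "(\<integral>s. 1 / (1 - w * cis s) \<partial>\<nu>) = (\<Sum>n. w ^ n * (\<integral>s. cis (real n * s) \<partial>\<nu>))"
    by simp
qed

section \<open>Resolvent forms of self-adjoint operators in the Donoghue class\<close>

text \<open>Expand \<open>cinner f g\<close> and \<open>(norm g)^2 = 1\<close> with
  \<open>cinner f f'\<close> real, and eliminate the latter. The identity yields both positivity of
  the imaginary part and, on the imaginary axis, the decay used to show that the measure is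
  infinite.\<close>

lemma Im_resolvent_form:
  assumes S: "self_adjoint S" and f: "(f, f') \<in> S" "f' - z *\<^sub>C f = g" "norm g = 1"
  shows "Im (z + (1 + z\<^sup>2) * cinner f g) = Im z * ((norm f')\<^sup>2 + (norm f)\<^sup>2)"
proof -
  define r where "r = Re (cinner f f')"
  have real: "Im (cinner f' f) = 0" by (rule self_adjoint_real_form[OF S f(1)])
  have r: "cinner f f' = of_real r" "cinner f' f = of_real r"
    using real cinner_commute[of f f'] by (auto simp: r_def complex_eq_iff)
  have fg: "cinner f g = of_real r - cnj z * of_real ((norm f)\<^sup>2)"
    unfolding f(2)[symmetric] by (simp only: cinner_simps r cinner_self)
  have "(norm (f' - z *\<^sub>C f))\<^sup>2 = (norm f')\<^sup>2 + (cmod z)\<^sup>2 * (norm f)\<^sup>2 - 2 * Re (cnj z * of_real r)"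
    by (simp add: norm_diff_square norm_scaleC cinner_simps r power_mult_distrib)
  then have one: "1 = (norm f')\<^sup>2 + ((Re z)\<^sup>2 + (Im z)\<^sup>2) * (norm f)\<^sup>2 - 2 * Re z * r"
    using f(2,3) by (simp add: cmod_power2)
  have "Im (z + (1 + z\<^sup>2) * cinner f g) =
      Im z * (1 + 2 * Re z * r - ((Re z)\<^sup>2 + (Im z)\<^sup>2) * (norm f)\<^sup>2 + (norm f)\<^sup>2)"
    unfolding fg by (simp add: power2_eq_square algebra_simps)
  also have "\<dots> = Im z * ((norm f')\<^sup>2 + (norm f)\<^sup>2)"
    using one by simp
  finally show ?thesis .
qed

text \<open>\<open>l = cot (s/2)\<close> is the real point with
  \<open>(l + \<i>) / (l - \<i>) = cis s\<close>, and \<open>w\<close> is the disc coordinate of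
  \<open>z\<close>. The first form matches the power series on the disc, the second is convenient
  for estimates.\<close>

lemma cayley_cot_kernel:
  fixes s :: real and z :: complex
  assumes z: "Im z > 0" and s: "cis s \<noteq> 1"
  defines "l \<equiv> cos (s / 2) / sin (s / 2)" and "w \<equiv> (z - \<i>) / (z + \<i>)"
  shows "(1 + l\<^sup>2) *\<^sub>R (1 / (of_real l - z) - of_real (l / (1 + l\<^sup>2))) = \<i> * (2 * (1 / (1 - w * cis s)) - 1)"
    and "(1 + l\<^sup>2) *\<^sub>R (1 / (of_real l - z) - of_real (l / (1 + l\<^sup>2))) = (1 + of_real l * z) / (of_real l - z)"
proof -
  define S C where "S = complex_of_real (sin (s / 2))" and "C = complex_of_real (cos (s / 2))"
  have CS: "C * C + S * S = 1"
    unfolding S_def C_def of_real_mult[symmetric] of_real_add[symmetric]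
    using sin_cos_squared_add2[of "s/2"] by (simp add: power2_eq_square)
  have cis: "cis s = (C + \<i> * S) * (C + \<i> * S)"
  proof -
    have "cis s = cis (s / 2) * cis (s / 2)" by (simp add: cis_mult)
    also have "cis (s / 2) = C + \<i> * S" by (simp add: complex_eq_iff S_def C_def)
    finally show ?thesis .
  qed
  have prod1: "(C + \<i> * S) * (C - \<i> * S) = 1" using CS by (simp add: algebra_simps)
  then have ne: "C - \<i> * S \<noteq> 0" by auto
  have S0: "S \<noteq> 0"
  proof
    assume "S = 0"
    then have "cis s = 1" using CS cis by simp
    then show False using s by simp
  qed
  have l: "of_real l = C / S" by (simp add: l_def S_def C_def)
  have lz: "of_real l - z \<noteq> 0" using z by (auto simp: complex_eq_iff)
  then have CzS: "C - z * S \<noteq> 0" using S0 by (simp add: l field_simps)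
  have zi: "z + \<i> \<noteq> 0" using z by (auto simp: complex_eq_iff)
  have l1: "1 + (complex_of_real l)\<^sup>2 \<noteq> 0"
  proof -
    have "1 + l\<^sup>2 \<noteq> 0" by (simp add: add_nonneg_eq_0_iff)
    then show ?thesis by (metis of_real_0 of_real_1 of_real_add of_real_eq_iff of_real_power)
  qed
  show A: "(1 + l\<^sup>2) *\<^sub>R (1 / (of_real l - z) - of_real (l / (1 + l\<^sup>2))) = (1 + of_real l * z) / (of_real l - z)"
  proof -
    have "(1 + l\<^sup>2) *\<^sub>R (1 / (of_real l - z) - of_real (l / (1 + l\<^sup>2)))
        = (1 + (of_real l)\<^sup>2) / (of_real l - z) - of_real l"
      using l1 by (simp add: scaleR_conv_of_real right_diff_distrib)
    then show ?thesis using lz by (simp add: divide_simps algebra_simps power2_eq_square)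
  qed
  also have "\<dots> = (S + C * z) / (C - z * S)"
    unfolding l using S0 CzS by (simp add: divide_simps)
  also have "\<dots> = \<i> * (2 * (1 / (1 - w * cis s)) - 1)"
  proof -
    have e: "cis s * (C - \<i> * S) = C + \<i> * S"
      unfolding cis by (simp only: mult.assoc prod1 mult_1_right)
    have wz: "w * (z + \<i>) = z - \<i>" using zi by (simp add: w_def)
    have "(1 - w * cis s) * ((z + \<i>) * (C - \<i> * S)) = (z + \<i>) * (C - \<i> * S) - (w * (z + \<i>)) * (cis s * (C - \<i> * S))"
      by (simp add: algebra_simps)
    also have "\<dots> = 2 * \<i> * (C - z * S)"
      unfolding e wz by (simp add: algebra_simps)
    finally have d: "1 - w * cis s = 2 * \<i> * (C - z * S) / ((z + \<i>) * (C - \<i> * S))"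
      using zi ne by (simp add: eq_divide_eq)
    show ?thesis
      unfolding d using zi ne CzS by (simp add: divide_simps) (simp add: algebra_simps)
  qed
  finally show "(1 + l\<^sup>2) *\<^sub>R (1 / (of_real l - z) - of_real (l / (1 + l\<^sup>2))) = \<i> * (2 * (1 / (1 - w * cis s)) - 1)" .
qed

lemma upper_half_plane_cayley:
  assumes "Im z > 0"
  shows "cmod ((z - \<i>) / (z + \<i>)) < 1"
proof -
  have "(cmod (z - \<i>))\<^sup>2 < (cmod (z + \<i>))\<^sup>2"
    unfolding cmod_power2 using assms by (simp add: power2_eq_square algebra_simps)
  then have "cmod (z - \<i>) < cmod (z + \<i>)" by (rule power2_less_imp_less) simp
  then show ?thesis by (simp add: norm_divide divide_less_eq)
qed

text \<open>Bounded coefficients give convergence on the unit disc, into which the Cayley map sends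
  the half-plane.\<close>

lemma power_series_analytic_upper_half_plane:
  fixes c :: "nat \<Rightarrow> complex"
  assumes c: "\<And>n. cmod (c n) \<le> 1"
    and V: "\<And>z. Im z > 0 \<Longrightarrow> V z = \<i> * (2 * (\<Sum>n. c n * ((z - \<i>) / (z + \<i>)) ^ n) - 1)"
  shows "V analytic_on {z. Im z > 0}"
proof -
  have summable: "summable (\<lambda>n. c n * w ^ n)" if "cmod w < 1" for w
  proof (rule summable_comparison_test')
    show "summable (\<lambda>n. cmod w ^ n)" using that by simp
    show "norm (c n * w ^ n) \<le> cmod w ^ n" for n
      using mult_right_mono[OF c[of n], of "cmod w ^ n"] by (simp add: norm_mult norm_power)
  qed
  have P: "(\<lambda>w. \<Sum>n. c n * w ^ n) holomorphic_on {w. cmod w < 1}"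
    unfolding holomorphic_on_def field_differentiable_def
    using termdiffs_strong'[OF summable] by (blast intro: has_field_derivative_at_within)
  have "(\<lambda>z. (z - \<i>) / (z + \<i>)) holomorphic_on {z. Im z > 0}"
    by (intro holomorphic_intros) (auto simp: complex_eq_iff)
  from holomorphic_on_compose_gen[OF this P]
  have "(\<lambda>z. \<Sum>n. c n * ((z - \<i>) / (z + \<i>)) ^ n) holomorphic_on {z. Im z > 0}"
    using upper_half_plane_cayley by (force simp: o_def)
  then have "(\<lambda>z. \<i> * (2 * (\<Sum>n. c n * ((z - \<i>) / (z + \<i>)) ^ n) - 1)) holomorphic_on {z. Im z > 0}"
    by (intro holomorphic_intros)
  then have "V holomorphic_on {z. Im z > 0}"
    by (rule holomorphic_transform) (simp add: V)
  then show ?thesis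
    by (simp add: analytic_on_open open_halfspace_Im_gt)
qed

text \<open>If \<open>y\<^sup>2 (\<parallel>f\<parallel>\<^sup>2 + \<parallel>f'\<parallel>\<^sup>2)\<close> stays bounded along \<open>f = (S - i y)\<^sup>-\<^sup>1 g\<close>, then \<open>S f = f' = g + i y f\<close>
  shows that the functional \<open>x \<mapsto> (S x, g)\<close> is bounded.\<close>

lemma self_adjoint_domain_if_resolvent_decay:
  fixes g :: "'h::chilbert_space" and m :: real
  assumes S: "self_adjoint S"
    and decay: "\<And>y::real. y > 0 \<Longrightarrow> \<exists>f f'. (f, f') \<in> S \<and> f' - (\<i> * complex_of_real y) *\<^sub>C f = g \<and> y * norm f' \<le> m \<and> y * norm f \<le> m"
  shows "g \<in> Domain S"
proof -
  have bound: "cmod (cinner x' g) \<le> m * norm x" if x: "(x, x') \<in> S" for x x'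
  proof (rule field_le_epsilon)
    fix e :: real assume e: "e > 0"
    \<comment> \<open>\<open>y\<close> is taken so large that the contribution
      \<open>norm x' * (m / y)\<close> falls below \<open>e\<close>.\<close>
    obtain y0 :: nat where y0: "real y0 > m * norm x' / e" using reals_Archimedean2 by blast
    define y where "y = real y0 + 1"
    have y: "y > 0" "y > m * norm x' / e" using y0 by (auto simp: y_def)
    obtain f f' where f: "(f, f') \<in> S" "f' - (\<i> * complex_of_real y) *\<^sub>C f = g" "y * norm f' \<le> m" "y * norm f \<le> m"
      using decay[OF y(1)] by blast
    \<comment> \<open>After substituting \<open>g = f' - \<i> y f\<close>, symmetry moves
      \<open>S\<close> from \<open>x\<close> onto \<open>f\<close>, so the factor \<open>y\<close>
      meets \<open>f'\<close>, where the decay absorbs it.\<close>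
    have "cinner x' g = cinner x' f' + \<i> * y * cinner x f'"
      unfolding f(2)[symmetric] using self_adjointD(4)[OF S x f(1)] by (simp add: cinner_simps)
    then have "cmod (cinner x' g) \<le> cmod (cinner x' f') + y * cmod (cinner x f')"
      using norm_triangle_ineq[of "cinner x' f'" "\<i> * y * cinner x f'"] y(1) by (simp add: norm_mult)
    also have "\<dots> \<le> norm x' * norm f' + y * (norm x * norm f')"
      using y(1) by (intro add_mono mult_left_mono Cauchy_Schwarz_cinner) auto
    also have "norm x' * norm f' \<le> norm x' * (m / y)"
      using f(3) y(1) by (intro mult_left_mono) (auto simp: field_simps)
    also have "norm x' * (m / y) \<le> e"
      using y e by (simp add: field_simps)
    also have "y * (norm x * norm f') \<le> m * norm x"
      using mult_right_mono[OF f(3), of "norm x"] by (simp add: ac_simps)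
    finally show "cmod (cinner x' g) \<le> m * norm x + e" by simp
  qed
  define G where "G = (\<lambda>(x, x'). (x, cinner x' g)) ` S"
  have "csubspace G"
  proof (rule complex_vector.subspaceI)
    show "0 \<in> G"
      unfolding G_def using complex_vector.subspace_0[OF self_adjointD(1)[OF S]]
      by (force simp: zero_prod_def image_iff)
    show "a + b \<in> G" if "a \<in> G" "b \<in> G" for a b
    proof -
      from that obtain x x' y y' where
        "(x, x') \<in> S" "a = (x, cinner x' g)" "(y, y') \<in> S" "b = (y, cinner y' g)"
        by (auto simp: G_def)
      then show ?thesis
        unfolding G_def using csubspace_pair(1)[OF self_adjointD(1)[OF S], of x x' y y']
        by (intro image_eqI[of _ _ "(x + y, x' + y')"]) (auto simp: cinner_simps)
    qed
    show "c *\<^sub>C a \<in> G" if "a \<in> G" for c a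
    proof -
      from that obtain x x' where "(x, x') \<in> S" "a = (x, cinner x' g)"
        by (auto simp: G_def)
      then show ?thesis
        unfolding G_def using csubspace_pair(3)[OF self_adjointD(1)[OF S], of x x' x x' c]
        by (intro image_eqI[of _ _ "(c *\<^sub>C x, c *\<^sub>C x')"])
          (auto simp: cinner_simps scaleC_prod_def scaleC_complex_def)
    qed
  qed
  moreover have "cmod c \<le> m * norm x" if "(x, c) \<in> G" for x c
    using that bound by (auto simp: G_def)
  ultimately obtain h where h: "\<And>x c. (x, c) \<in> G \<Longrightarrow> c = cinner x h"
    using Riesz_graph by blast
  have "(g, h) \<in> adj S"
    by (rule adjI) (rule h, force simp: G_def)
  then show ?thesis using self_adjointD(2)[OF S] by auto
qed

lemma Donoghue_class_if_resolvent_form: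
  fixes g :: "'h::chilbert_space"
  assumes S: "self_adjoint S" and g: "norm g = 1" "g \<notin> Domain S"
    and V: "\<And>z. Im z > 0 \<Longrightarrow> \<exists>f f'. (f, f') \<in> S \<and> f' - z *\<^sub>C f = g \<and> V z = z + (1 + z\<^sup>2) * cinner f g"
  shows "V \<in> Donoghue_class"
proof -
  obtain W where W: "\<And>f f'. (f, f') \<in> S \<Longrightarrow> W (f' - \<i> *\<^sub>C f) = f' + \<i> *\<^sub>C f"
    and lin: "\<And>x y. W (x + y) = W x + W y" "\<And>c x. W (c *\<^sub>C x) = c *\<^sub>C W x"
    and iso: "\<And>x y. cinner (W x) (W y) = cinner x y"
    using cayley_transform[OF S] by blast
  interpret linear_isometry W by standard (fact lin iso)+
  define c where "c n = cinner ((W ^^ n) g) g" for n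
  define \<omega> where "\<omega> z = (z - \<i>) / (z + \<i>)" for z
  have \<omega>: "cmod (\<omega> z) < 1" if "Im z > 0" for z
    unfolding \<omega>_def using that by (rule upper_half_plane_cayley)
  have sums: "(\<lambda>n. \<omega> z ^ n * c n) sums ((z + \<i>) / (2 * \<i>) * (1 + (z - \<i>) * cinner f g))"
    if z: "Im z > 0" and f: "(f, f') \<in> S" "f' - z *\<^sub>C f = g" for z f f'
  proof -
    \<comment> \<open>Chosen so that \<open>F = a (f' - \<i> f)\<close> satisfies
      \<open>F - \<omega> z W F = f' - z f = g\<close>, which is the equation solved by the Neumann
      series.\<close>
    define a where "a = (z + \<i>) / (2 * \<i>)"
    have zi: "z + \<i> \<noteq> 0" using z by (auto simp: complex_eq_iff)
    have a: "a - \<omega> z * a = 1" "\<i> * (a + \<omega> z * a) = z"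
    proof -
      have "\<omega> z * a = (z - \<i>) / (2 * \<i>)" using zi by (simp add: a_def \<omega>_def)
      moreover have "a - (z - \<i>) / (2 * \<i>) = 1" "\<i> * (a + (z - \<i>) / (2 * \<i>)) = z"
        by (simp_all add: a_def field_simps)
      ultimately show "a - \<omega> z * a = 1" "\<i> * (a + \<omega> z * a) = z" by simp_all
    qed
    define F where "F = a *\<^sub>C (f' - \<i> *\<^sub>C f)"
    have WF: "W F = a *\<^sub>C (f' + \<i> *\<^sub>C f)" by (simp add: F_def lin(2) W[OF f(1)])
    have "F - \<omega> z *\<^sub>C W F = (a - \<omega> z * a) *\<^sub>C f' - (\<i> * (a + \<omega> z * a)) *\<^sub>C f"
      unfolding WF by (simp add: F_def scaleC_simps complex_vector.scale_right_diff_distrib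
          complex_vector.scale_left_diff_distrib algebra_simps)
    then have "F - \<omega> z *\<^sub>C W F = g" using f(2) by (simp add: a scaleC_one)
    from resolvent_sums[OF this \<omega>[OF z], of g]
    have "(\<lambda>n. \<omega> z ^ n * c n) sums cinner F g" by (simp add: c_def)
    moreover have "F = a *\<^sub>C (g + (z - \<i>) *\<^sub>C f)"
      using f(2) by (simp add: F_def complex_vector.scale_left_diff_distrib algebra_simps)
    ultimately show ?thesis by (simp add: a_def cinner_simps cinner_self g(1))
  qed
  have V_series: "V z = \<i> * (2 * (\<Sum>n. \<omega> z ^ n * c n) - 1)" if z: "Im z > 0" for z
  proof -
    obtain f f' where f: "(f, f') \<in> S" "f' - z *\<^sub>C f = g" "V z = z + (1 + z\<^sup>2) * cinner f g"
      using V[OF z] by blast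
    show ?thesis
      unfolding f(3) sums_unique[OF sums[OF z f(1,2)], symmetric]
      by (simp add: field_simps power2_eq_square)
  qed
  obtain \<nu> where \<nu>: "real_distribution \<nu>" and moments: "\<And>n. (\<integral>s. cis (real n * s) \<partial>\<nu>) = c n"
    using stationary_sequence_spectral_measure[of "\<lambda>n. (W ^^ n) g"] g(1)
    by (auto simp: iso c_def)
  interpret real_distribution \<nu> by fact
  have dense: "closure {W h - h | h. True} = UNIV"
  proof -
    have "Domain S \<subseteq> {W h - h | h. True}"
    proof
      fix f assume "f \<in> Domain S"
      then obtain f' where f: "(f, f') \<in> S" by auto
      \<comment> \<open>For this \<open>h\<close>, \<open>W h - h = f\<close>; hence the range of
        \<open>W - 1\<close> contains the dense domain of \<open>S\<close>.\<close>
      define h where "h = (1 / (2 * \<i>)) *\<^sub>C (f' - \<i> *\<^sub>C f)"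
      have "W h = (1 / (2 * \<i>)) *\<^sub>C (f' + \<i> *\<^sub>C f)" by (simp only: h_def lin(2) W[OF f])
      then have "W h - h = (1 / (2 * \<i>)) *\<^sub>C ((f' + \<i> *\<^sub>C f) - (f' - \<i> *\<^sub>C f))"
        by (simp only: h_def complex_vector.scale_right_diff_distrib)
      also have "(f' + \<i> *\<^sub>C f) - (f' - \<i> *\<^sub>C f) = (2 * \<i>) *\<^sub>C f"
        by (simp add: scaleC_add_left[symmetric])
      finally show "f \<in> {W h - h | h. True}" by (auto simp: scaleC_scaleC scaleC_one intro!: exI[of _ h])
    qed
    from closure_mono[OF this] self_adjointD(3)[OF S] show ?thesis by auto
  qed
  have AE: "AE s in \<nu>. cis s \<noteq> 1"
    using mean_ergodic_zero[OF dense, of g g] by (intro AE_cis_neq_1[OF \<nu>]) (simp add: moments c_def)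
  \<comment> \<open>Where \<open>sin (s / 2) = 0\<close> the quotient takes the default value
    \<open>0\<close>; there \<open>cis s = 1\<close>, which by \<open>AE\<close> is a null
    set.\<close>
  define l :: "real \<Rightarrow> real" where "l s = cos (s / 2) / sin (s / 2)" for s
  have l_measurable [measurable]: "l \<in> borel_measurable borel"
    unfolding l_def by (intro borel_measurable_divide borel_measurable_continuous_onI continuous_intros) auto
  \<comment> \<open>The weight cancels the factor \<open>1 / (1 + t^2)\<close> of the normalization,
    leaving the total mass of \<open>\<nu>\<close>.\<close>
  define \<mu> where "\<mu> = density (distr \<nu> borel l) (\<lambda>t. ennreal (1 + t\<^sup>2))"
  have nn_mu: "(\<integral>\<^sup>+t. h t \<partial>\<mu>) = (\<integral>\<^sup>+s. ennreal (1 + (l s)\<^sup>2) * h (l s) \<partial>\<nu>)"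
    if [measurable]: "h \<in> borel_measurable borel" for h
    by (simp add: \<mu>_def nn_integral_density nn_integral_distr)
  have int_mu: "(\<integral>t. h t \<partial>\<mu>) = (\<integral>s. (1 + (l s)\<^sup>2) *\<^sub>R h (l s) \<partial>\<nu>)"
    if [measurable]: "h \<in> borel_measurable borel" for h :: "real \<Rightarrow> complex"
    unfolding \<mu>_def by (subst integral_density) (simp_all add: integral_distr)
  have kernel: "V z = (\<integral>t. 1 / (of_real t - z) - of_real (t / (1 + t\<^sup>2)) \<partial>\<mu>)"
    and kernel': "has_bochner_integral \<nu> (\<lambda>s. (1 + of_real (l s) * z) / (of_real (l s) - z)) (V z)"
    if z: "Im z > 0" for z
  proof -
    have [measurable]: "(\<lambda>t. 1 / (complex_of_real t - z) - of_real (t / (1 + t\<^sup>2))) \<in> borel_measurable borel"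
      by measurable
    have int: "has_bochner_integral \<nu> (\<lambda>s. \<i> * (2 * (1 / (1 - \<omega> z * cis s)) - 1)) (V z)"
    proof -
      have "has_bochner_integral \<nu> (\<lambda>s. 1 / (1 - \<omega> z * cis s)) (\<Sum>n. \<omega> z ^ n * c n)"
        using integral_geometric_cis[OF \<nu> \<omega>[OF z]] by (simp add: has_bochner_integral_iff moments)
      moreover have "has_bochner_integral \<nu> (\<lambda>s. 1 :: complex) 1"
        using prob_space by (simp add: has_bochner_integral_iff)
      ultimately show ?thesis
        unfolding V_series[OF z]
        by (intro has_bochner_integral_mult_right has_bochner_integral_diff)
    qed
    have "V z = (\<integral>s. (1 + (l s)\<^sup>2) *\<^sub>R (1 / (of_real (l s) - z) - of_real (l s / (1 + (l s)\<^sup>2))) \<partial>\<nu>)"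
      unfolding has_bochner_integral_integral_eq[OF int, symmetric]
    proof (rule integral_cong_AE)
      show "AE s in \<nu>. \<i> * (2 * (1 / (1 - \<omega> z * cis s)) - 1)
          = (1 + (l s)\<^sup>2) *\<^sub>R (1 / (of_real (l s) - z) - of_real (l s / (1 + (l s)\<^sup>2)))"
        using AE
      proof eventually_elim
        case (elim s)
        show ?case
          using cayley_cot_kernel(1)[OF z elim] unfolding l_def \<omega>_def by (simp only:)
      qed
    qed simp_all
    then show "V z = (\<integral>t. 1 / (of_real t - z) - of_real (t / (1 + t\<^sup>2)) \<partial>\<mu>)"
      by (subst int_mu) simp_all
    show "has_bochner_integral \<nu> (\<lambda>s. (1 + of_real (l s) * z) / (of_real (l s) - z)) (V z)"
    proof (rule has_bochner_integral_cong_AE[THEN iffD1, OF _ _ _ int])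
      show "AE s in \<nu>. \<i> * (2 * (1 / (1 - \<omega> z * cis s)) - 1)
          = (1 + of_real (l s) * z) / (of_real (l s) - z)"
        using AE
      proof eventually_elim
        case (elim s)
        show ?case
          using cayley_cot_kernel[OF z elim] unfolding l_def \<omega>_def by (simp only:)
      qed
    qed simp_all
  qed
  \<comment> \<open>A finite total mass \<open>m\<close> would give
    \<open>Im (V (\<i> y)) \<le> m / y\<close>, and \<open>Im_resolvent_form\<close> turns this into
    the decay that puts \<open>g\<close> into the domain of \<open>S\<close>.\<close>
  have "emeasure \<mu> UNIV = \<infinity>"
  proof (rule ccontr)
    assume "emeasure \<mu> UNIV \<noteq> \<infinity>"
    moreover have "emeasure \<mu> UNIV = (\<integral>\<^sup>+s. ennreal (1 + (l s)\<^sup>2) \<partial>\<nu>)"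
      using nn_mu[of "\<lambda>_. 1"] by (simp add: \<mu>_def)
    ultimately have int: "integrable \<nu> (\<lambda>s. 1 + (l s)\<^sup>2)"
      by (intro integrableI_nonneg) (auto simp: top.not_eq_extremum)
    define m where "m = (\<integral>s. 1 + (l s)\<^sup>2 \<partial>\<nu>)"
    have m: "m \<ge> 0" unfolding m_def by (intro integral_nonneg_AE) auto
    have "g \<in> Domain S"
    proof (rule self_adjoint_domain_if_resolvent_decay[OF S, where m = "sqrt m"])
      fix y :: real assume y: "y > 0"
      then have z: "Im (\<i> * complex_of_real y) > 0" by simp
      obtain f f' where f: "(f, f') \<in> S" "f' - (\<i> * complex_of_real y) *\<^sub>C f = g" "V (\<i> * y) = \<i> * y + (1 + (\<i> * y)\<^sup>2) * cinner f g"
        using V[OF z] by blast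
      have "Im (V (\<i> * y)) = (\<integral>s. Im ((1 + of_real (l s) * (\<i> * y)) / (of_real (l s) - \<i> * y)) \<partial>\<nu>)"
        using has_bochner_integral_Im[OF kernel'[OF z]] by (simp add: has_bochner_integral_iff)
      also have "\<dots> \<le> (\<integral>s. (1 + (l s)\<^sup>2) / y \<partial>\<nu>)"
      proof (rule integral_mono)
        show "integrable \<nu> (\<lambda>s. Im ((1 + of_real (l s) * (\<i> * y)) / (of_real (l s) - \<i> * y)))"
          using has_bochner_integral_Im[OF kernel'[OF z]] by (simp add: has_bochner_integral_iff)
        show "integrable \<nu> (\<lambda>s. (1 + (l s)\<^sup>2) / y)" using int by simp
        fix s
        have "Im ((1 + of_real (l s) * (\<i> * y)) / (of_real (l s) - \<i> * y)) = y * (1 + (l s)\<^sup>2) / ((l s)\<^sup>2 + y\<^sup>2)"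
          by (simp add: Im_divide power2_eq_square algebra_simps)
        also have "\<dots> \<le> y * (1 + (l s)\<^sup>2) / y\<^sup>2"
          using y by (intro divide_left_mono) (auto simp: add_nonneg_pos)
        finally show "Im ((1 + of_real (l s) * (\<i> * y)) / (of_real (l s) - \<i> * y)) \<le> (1 + (l s)\<^sup>2) / y"
          using y by (simp add: power2_eq_square)
      qed
      also have "\<dots> = m / y" by (simp add: m_def)
      finally have "y * ((norm f')\<^sup>2 + (norm f)\<^sup>2) \<le> m / y"
        using Im_resolvent_form[OF S f(1,2) g(1)] unfolding f(3) by simp
      then have *: "(y * norm f')\<^sup>2 + (y * norm f)\<^sup>2 \<le> m"
        using y by (simp add: field_simps power2_eq_square)
      have "y * norm f' \<le> sqrt m" "y * norm f \<le> sqrt m"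
        using * by (auto intro!: real_le_rsqrt) (smt (verit) zero_le_power2)+
      with f show "\<exists>f f'. (f, f') \<in> S \<and> f' - (\<i> * complex_of_real y) *\<^sub>C f = g \<and> y * norm f' \<le> sqrt m \<and> y * norm f \<le> sqrt m"
        by blast
    qed
    then show False using g(2) by simp
  qed
  moreover have "(\<integral>\<^sup>+t. ennreal (1 / (1 + t\<^sup>2)) \<partial>\<mu>) = 1"
  proof -
    have "(\<integral>\<^sup>+t. ennreal (1 / (1 + t\<^sup>2)) \<partial>\<mu>) = (\<integral>\<^sup>+s. 1 \<partial>\<nu>)"
    proof (subst nn_mu, simp, rule nn_integral_cong)
      fix s
      have "1 + (l s)\<^sup>2 \<noteq> 0" by (simp add: add_nonneg_eq_0_iff)
      then show "ennreal (1 + (l s)\<^sup>2) * ennreal (1 / (1 + (l s)\<^sup>2)) = 1"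
        by (subst ennreal_mult[symmetric]) auto
    qed
    then show ?thesis using emeasure_space_1 by simp
  qed
  moreover have "V analytic_on {z. Im z > 0}"
  proof (rule power_series_analytic_upper_half_plane)
    show "cmod (c n) \<le> 1" for n
      using Cauchy_Schwarz_cinner[of "(W ^^ n) g" g] by (simp add: c_def norm_pow g(1))
    show "V z = \<i> * (2 * (\<Sum>n. c n * ((z - \<i>) / (z + \<i>)) ^ n) - 1)" if "Im z > 0" for z
      using V_series[OF that] by (simp add: \<omega>_def mult.commute)
  qed
  moreover have "Im (V z) > 0" if z: "Im z > 0" for z
  proof -
    obtain f f' where f: "(f, f') \<in> S" "f' - z *\<^sub>C f = g" "V z = z + (1 + z\<^sup>2) * cinner f g"
      using V[OF z] by blast
    have "f \<noteq> 0 \<or> f' \<noteq> 0" using f(2) g(1) by auto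
    then have "0 < (norm f')\<^sup>2 + (norm f)\<^sup>2"
      by (auto simp: add_pos_nonneg add_nonneg_pos)
    then show ?thesis
      using Im_resolvent_form[OF S f(1,2) g(1)] z unfolding f(3) by simp
  qed
  moreover have "sets \<mu> = sets borel" by (simp add: \<mu>_def)
  ultimately show ?thesis unfolding Donoghue_class_def using kernel by blast
qed

section \<open>The impedance function of an L-system\<close>

lemma embed_add: "embed A (x + y) = embed A x + embed A y"
  by (auto simp: embed_def cinner_simps fun_eq_iff)

lemma embed_scale: "embed A (c *\<^sub>C x) = c *\<^sub>C embed A x"
  by (auto simp: embed_def cinner_simps fun_eq_iff scaleC_fun_def scaleC_complex_def)

lemma op_kernel_iff: "f \<in> op_kernel T z \<longleftrightarrow> (f, z *\<^sub>C f) \<in> T"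
  by (auto simp: op_kernel_def)

lemma csubspace_op_kernel: "csubspace T \<Longrightarrow> csubspace (op_kernel T z)"
proof (rule complex_vector.subspaceI)
  assume T: "csubspace T"
  show "0 \<in> op_kernel T z"
    using complex_vector.subspace_0[OF T] by (simp add: op_kernel_iff zero_prod_def)
  show "x + y \<in> op_kernel T z" if "x \<in> op_kernel T z" "y \<in> op_kernel T z" for x y
    using csubspace_pair(1)[OF T, of x _ y] that by (simp add: op_kernel_iff scaleC_add_right)
  show "c *\<^sub>C x \<in> op_kernel T z" if "x \<in> op_kernel T z" for c x
    using csubspace_pair(3)[OF T, of x _ x _ c] that
    by (metis op_kernel_iff mult.commute scaleC_scaleC)
qed

lemma cdim_one_multiple:
  assumes V: "csubspace V" "cdim V = 1" and x: "x \<in> V" "x \<noteq> 0" and y: "y \<in> V"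
  obtains c where "y = c *\<^sub>C x"
proof -
  obtain B where B: "B \<subseteq> V" "V \<subseteq> cspan B" "card B = cdim V"
    by (rule complex_vector.basis_exists[of V])
  then obtain b where "B = {b}" using V(2) by (auto simp: card_1_singleton_iff)
  then have "V \<subseteq> range (\<lambda>k. k *\<^sub>C b)"
    using B(2) by (simp add: complex_vector.span_singleton)
  then obtain p q where pq: "x = p *\<^sub>C b" "y = q *\<^sub>C b"
    using x(1) y by (meson imageE subsetD)
  then have "p \<noteq> 0" using x(2) by auto
  then have "y = (q / p) *\<^sub>C x" using pq by (simp add: scaleC_scaleC)
  then show ?thesis by (rule that)
qed

text \<open>If \<open>\<BB>\<^sup>*\<close> extends \<open>A\<close> then \<open>(\<BB> f, g) = (f, A g)\<close> for \<open>g\<close> in the domain of \<open>A\<close>.\<close>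

lemma quasi_kernel_subset_adj:
  assumes "bi_extends A (adj_pm A \<BB>) A"
  shows "quasi_kernel A \<BB> \<subseteq> adj A"
proof clarify
  fix f h assume fh: "(f, h) \<in> quasi_kernel A \<BB>"
  then have f: "f \<in> Hplus A" "\<BB> f = embed A h" by (auto simp: quasi_kernel_def)
  show "(f, h) \<in> adj A"
  proof (rule adjI)
    fix g g' assume "(g, g') \<in> A"
    then have g: "g \<in> Hplus A" "adj_pm A \<BB> g = embed A g'"
      using assms by (auto simp: bi_extends_def)
    from fun_cong[OF g(2), of f] have "cnj (cinner h g) = cinner g' f"
      using f g(1) by (simp add: adj_pm_def embed_def pairing_def)
    then show "cinner g' f = cinner g h" using cinner_commute[of g h] by simp
  qed
qed

text \<open>The chosen preimage of \<open>K 1\<close> must be shown to be \<open>f\<close>: the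
  difference of two preimages would be an eigenvector of the self-adjoint quasi-kernel for the
  non-real number \<open>z\<close>.\<close>

lemma impedance_eqI:
  assumes lin: "clinear_on (Hplus A) (Re_op A \<AA>)" and S: "self_adjoint (quasi_kernel A (Re_op A \<AA>))"
    and z: "Im z \<noteq> 0" and f: "f \<in> Hplus A" "Re_op A \<AA> f - z *\<^sub>C embed A f = K 1"
  shows "impedance A \<AA> K z = adj_K K f"
proof -
  have "inj_on (\<lambda>f. Re_op A \<AA> f - z *\<^sub>C embed A f) (Hplus A)"
  proof (rule inj_onI)
    fix x y assume xy: "x \<in> Hplus A" "y \<in> Hplus A"
      "Re_op A \<AA> x - z *\<^sub>C embed A x = Re_op A \<AA> y - z *\<^sub>C embed A y"
    have my: "- y \<in> Hplus A" "Re_op A \<AA> (- y) = - Re_op A \<AA> y"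
    proof -
      obtain y' where "(y, y') \<in> adj A" using xy(2) by (auto simp: Hplus_def)
      from csubspace_pair(3)[OF csubspace_adj this this, of "-1"] show "- y \<in> Hplus A"
        by (auto simp: Hplus_def scaleC_minus_one)
      show "Re_op A \<AA> (- y) = - Re_op A \<AA> y"
        using lin xy(2) scaleC_minus_one[of y] scaleC_minus_one[of "Re_op A \<AA> y"]
        unfolding clinear_on_def by metis
    qed
    have "x - y \<in> Hplus A"
    proof -
      obtain x' y' where "(x, x') \<in> adj A" "(y, y') \<in> adj A" using xy(1,2) by (auto simp: Hplus_def)
      from csubspace_pair(2)[OF csubspace_adj this] show ?thesis by (auto simp: Hplus_def)
    qed
    moreover have "Re_op A \<AA> (x - y) = embed A (z *\<^sub>C (x - y))"
    proof -
      have "Re_op A \<AA> (x + - y) = Re_op A \<AA> x + Re_op A \<AA> (- y)"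
        using lin xy(1) my(1) unfolding clinear_on_def by blast
      then have "Re_op A \<AA> (x - y) = Re_op A \<AA> x - Re_op A \<AA> y"
        using my(2) by simp
      also have "\<dots> = z *\<^sub>C embed A x - z *\<^sub>C embed A y"
        using xy(3) by (simp add: algebra_simps)
      also have "\<dots> = embed A (z *\<^sub>C (x - y))"
        using embed_add[of A "z *\<^sub>C (x - y)" "z *\<^sub>C y"]
        by (simp add: embed_scale complex_vector.scale_right_diff_distrib)
      finally show ?thesis .
    qed
    ultimately have "(x - y, z *\<^sub>C (x - y)) \<in> quasi_kernel A (Re_op A \<AA>)"
      by (simp add: quasi_kernel_def)
    from self_adjoint_no_eigenvalue[OF S this z] show "x = y" by simp
  qed
  from inv_into_f_eq[OF this f] show ?thesis by (simp only: impedance_def)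
qed

text \<open>At \<open>z = \<i>\<close> the integrand is \<open>\<i> / (1 + t^2)\<close>, so the
  value is fixed by the normalization of the measure.\<close>

lemma Donoghue_class_at_i:
  assumes "M \<in> Donoghue_class"
  shows "M \<i> = \<i>"
proof -
  from assms obtain \<mu> :: "real measure" where sets: "sets \<mu> = sets borel"
    and one: "(\<integral>\<^sup>+t. ennreal (1 / (1 + t\<^sup>2)) \<partial>\<mu>) = 1"
    and M: "M \<i> = (\<integral>t. 1 / (of_real t - \<i>) - of_real (t / (1 + t\<^sup>2)) \<partial>\<mu>)"
    by (auto simp: Donoghue_class_def)
  note [measurable_cong] = sets
  have "has_bochner_integral \<mu> (\<lambda>t. 1 / (1 + t\<^sup>2)) 1"
    by (rule has_bochner_integral_nn_integral) (auto simp: one)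
  then have "has_bochner_integral \<mu> (\<lambda>t. \<i> * complex_of_real (1 / (1 + t\<^sup>2))) (\<i> * complex_of_real 1)"
    by (intro has_bochner_integral_mult_right has_bochner_integral_of_real)
  moreover have "1 / (of_real t - \<i>) - of_real (t / (1 + t\<^sup>2)) = \<i> * complex_of_real (1 / (1 + t\<^sup>2))" for t
  proof -
    have t: "of_real t - \<i> \<noteq> 0" "of_real t + \<i> \<noteq> 0" by (auto simp: complex_eq_iff)
    have "complex_of_real (1 + t\<^sup>2) = (of_real t - \<i>) * (of_real t + \<i>)"
      by (simp add: algebra_simps power2_eq_square)
    then show ?thesis using t by (simp only: of_real_divide) (simp add: divide_simps)
  qed
  ultimately show ?thesis
    unfolding M by (simp add: has_bochner_integral_integral_eq)
qed

section \<open>Structure of an L-system\<close>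

lemma L_system_main_operator_subset_adj:
  assumes "L_system A \<AA> K"
  shows "main_operator A \<AA> \<subseteq> adj A"
proof -
  from assms obtain T where "star_extension A T \<AA>" by (auto simp: L_system_def)
  then have "bi_extends A (adj_pm A \<AA>) A" by (auto simp: star_extension_def bi_extends_def)
  then show ?thesis unfolding main_operator_def by (rule quasi_kernel_subset_adj)
qed

lemma L_system_Re_op:
  assumes "L_system A \<AA> K"
  shows "t_self_adjoint_bi_extension A (Re_op A \<AA>)"
  using assms by (auto simp: L_system_def star_extension_def)

lemma t_self_adjoint_bi_extension_quasi_kernel:
  assumes "t_self_adjoint_bi_extension A \<BB>"
  shows "clinear_on (Hplus A) \<BB>" "self_adjoint (quasi_kernel A \<BB>)" "quasi_kernel A \<BB> \<subseteq> adj A"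
proof -
  show "clinear_on (Hplus A) \<BB>" and S: "self_adjoint (quasi_kernel A \<BB>)"
    using assms by (auto simp: t_self_adjoint_bi_extension_def ops_plus_minus_def bounded_ops_def)
  have "A \<subseteq> quasi_kernel A \<BB>"
    using assms by (auto simp: t_self_adjoint_bi_extension_def bi_extends_def quasi_kernel_def)
  then show "quasi_kernel A \<BB> \<subseteq> adj A"
    using adj_antimono[of A "quasi_kernel A \<BB>"] self_adjointD(2)[OF S] by simp
qed

lemma t_self_adjoint_bi_extension_symmetric:
  assumes "t_self_adjoint_bi_extension A \<BB>" "f \<in> Hplus A" "g \<in> Hplus A"
  shows "\<BB> f g = cnj (\<BB> g f)"
proof -
  have "adj_pm A \<BB> f g = \<BB> f g"
    using assms by (simp add: t_self_adjoint_bi_extension_def)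
  then show ?thesis using assms(3) by (simp add: adj_pm_def pairing_def)
qed

text \<open>Split \<open>\<AA>\<close> into real and imaginary part; the latter factors through the
  scalars and so has rank at most one, with range spanned by \<open>K 1\<close>.\<close>

lemma L_system_decomposition:
  assumes L: "L_system A \<AA> K" and f: "f \<in> Hplus A"
  shows "\<AA> f = Re_op A \<AA> f + (\<i> * adj_K K f) *\<^sub>C K 1"
proof -
  have "clinear_on UNIV K" using L by (simp add: L_system_def bounded_ops_def)
  then have "K (adj_K K f *\<^sub>C 1) = adj_K K f *\<^sub>C K 1" unfolding clinear_on_def by blast
  then have "Im_op A \<AA> f = adj_K K f *\<^sub>C K 1"
    using L f by (simp add: L_system_def scaleC_complex_def)
  then have "\<i> *\<^sub>C Im_op A \<AA> f = (\<i> * adj_K K f) *\<^sub>C K 1" by (simp add: scaleC_scaleC)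
  moreover have "\<AA> f = Re_op A \<AA> f + \<i> *\<^sub>C Im_op A \<AA> f"
    by (simp add: fun_eq_iff Re_op_def Im_op_def scaleC_fun_def scaleC_complex_def field_simps)
  ultimately show ?thesis by simp
qed

lemma L_system_adj_K_linear:
  assumes "L_system A \<AA> K"
  shows "f \<in> Hplus A \<Longrightarrow> g \<in> Hplus A \<Longrightarrow> adj_K K (f + g) = adj_K K f + adj_K K g"
    and "f \<in> Hplus A \<Longrightarrow> adj_K K (c *\<^sub>C f) = c * adj_K K f"
proof -
  have lin: "clinear_on (Hplus A) (adj_K K)"
    using assms unfolding L_system_def bounded_ops_def by blast
  show "adj_K K (f + g) = adj_K K f + adj_K K g" if "f \<in> Hplus A" "g \<in> Hplus A"
    using lin that unfolding clinear_on_def by blast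
  show "adj_K K (c *\<^sub>C f) = c * adj_K K f" if "f \<in> Hplus A"
    using lin that unfolding clinear_on_def scaleC_complex_def[symmetric] by blast
qed

text \<open>On the domain of the main operator \<open>\<AA>\<close> agrees with the adjoint of \<open>A\<close>, so there
  \<open>Re \<AA> = A\<^sup>* - i (\<cdot>, K 1) K 1\<close>; on the domain of the quasi-kernel of \<open>Re \<AA>\<close>, \<open>Re \<AA> = A\<^sup>*\<close>.
  Since the latter has codimension one in the positive space, together they determine
  \<open>Re \<AA>\<close> at the deficiency vector \<open>gp\<close>.\<close>

lemma L_system_deficiency_vector:
  fixes A :: "('h::chilbert_space \<times> 'h) set"
  assumes dense: "densely_defined A" and def: "deficiency_indices A = (1, 1)"
    and L: "L_system A \<AA> K"
    and \<kappa>: "0 \<le> \<kappa>" "\<kappa> < 1"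
    and gp: "(gp, \<i> *\<^sub>C gp) \<in> adj A" "norm gp = 1"
    and gm: "(gm, (- \<i>) *\<^sub>C gm) \<in> adj A" "norm gm = 1"
    and dom: "gp - complex_of_real \<kappa> *\<^sub>C gm \<in> Domain (main_operator A \<AA>)"
  obtains \<eta> where "\<eta> \<noteq> 0" "Re_op A \<AA> gp = embed A (\<i> *\<^sub>C gp) + \<eta> *\<^sub>C K 1"
proof -
  let ?B = "Re_op A \<AA>" and ?S = "quasi_kernel A (Re_op A \<AA>)"
  note main = L_system_main_operator_subset_adj[OF L]
  note lin = t_self_adjoint_bi_extension_quasi_kernel(1)[OF L_system_Re_op[OF L]]
    and S = t_self_adjoint_bi_extension_quasi_kernel(2)[OF L_system_Re_op[OF L]]
    and SA = t_self_adjoint_bi_extension_quasi_kernel(3)[OF L_system_Re_op[OF L]]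
  define k where "k = complex_of_real \<kappa>"
  \<comment> \<open>\<open>t\<close> is the vector supplied by the von Neumann parameter and
    \<open>t'\<close> its image under the adjoint of \<open>A\<close>; the eigenvalue
    \<open>- \<i>\<close> of \<open>gm\<close> accounts for the plus sign.\<close>
  define t t' where "t = gp - k *\<^sub>C gm" and "t' = \<i> *\<^sub>C gp + (\<i> * k) *\<^sub>C gm"
  have tA: "(t, t') \<in> adj A"
    using csubspace_pair(2)[OF csubspace_adj gp(1) csubspace_pair(3)[OF csubspace_adj gm(1) gm(1), of k]]
    by (simp add: t_def t'_def scaleC_scaleC mult.commute)
  obtain t'' where "(t, t'') \<in> main_operator A \<AA>" using dom by (auto simp: t_def k_def)
  moreover from this have "t'' = t'"
    using main adj_single_valued[OF dense _ tA] by blast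
  ultimately have tM: "t \<in> Hplus A" "\<AA> t = embed A t'"
    by (auto simp: main_operator_def quasi_kernel_def)
  \<comment> \<open>Solving with \<open>S - \<i>\<close> splits \<open>t\<close> along the domain of
    \<open>S\<close>: the remainder \<open>t - a\<close> is in the deficiency subspace at
    \<open>\<i>\<close>, which \<open>gp\<close> spans.\<close>
  obtain a a' where a: "(a, a') \<in> ?S" "a' - \<i> *\<^sub>C a = t' - \<i> *\<^sub>C t"
    using self_adjoint_surj[OF S, of \<i> "t' - \<i> *\<^sub>C t"] by auto
  have aA: "(a, a') \<in> adj A" using a(1) SA by auto
  have "(t - a, t' - a') \<in> adj A" by (rule csubspace_pair(2)[OF csubspace_adj tA aA])
  moreover have ta': "t' - a' = \<i> *\<^sub>C (t - a)"
    using a(2) by (simp add: complex_vector.scale_right_diff_distrib algebra_simps)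
  ultimately have "t - a \<in> op_kernel (adj A) \<i>" by (simp add: op_kernel_iff)
  moreover have "gp \<in> op_kernel (adj A) \<i>" using gp(1) by (simp add: op_kernel_iff)
  moreover have "gp \<noteq> 0" using gp(2) by auto
  moreover have "cdim (op_kernel (adj A) \<i>) = 1" using def by (simp add: deficiency_indices_def)
  ultimately obtain c where c: "t - a = c *\<^sub>C gp"
    using cdim_one_multiple[OF csubspace_op_kernel[OF csubspace_adj]] by metis
  \<comment> \<open>Otherwise \<open>t\<close> is in the domain of \<open>S\<close>, whose form is
    real, while the imaginary part of \<open>cinner t' t\<close> is
    \<open>1 - \<kappa>^2 > 0\<close>.\<close>
  have "c \<noteq> 0"
  proof
    assume "c = 0"
    then have "(t, t') \<in> ?S" using c ta' a(1) by simp
    from self_adjoint_real_form[OF S this] have "Im (cinner t' t) = 0" .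
    moreover have "cinner t' t = \<i> * of_real (1 - \<kappa>\<^sup>2) + \<i> * k * (cinner gm gp - cnj (cinner gm gp))"
      unfolding cinner_commute[of gp gm, symmetric]
      by (simp add: t_def t'_def cinner_simps cinner_self gp(2) gm(2) k_def power2_eq_square algebra_simps)
    moreover have "Im (\<i> * k * (cinner gm gp - cnj (cinner gm gp))) = 0" by (simp add: k_def)
    ultimately have "1 - \<kappa>\<^sup>2 = 0" by simp
    then have "\<kappa>\<^sup>2 = 1" by simp
    then show False using \<kappa> by (simp add: power2_eq_1_iff)
  qed
  have gp_eq: "t = a + c *\<^sub>C gp" using c by (simp add: algebra_simps)
  have gpH: "gp \<in> Hplus A" and aH: "a \<in> Hplus A" using gp(1) aA by (auto simp: Hplus_def)
  have cgpH: "c *\<^sub>C gp \<in> Hplus A"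
    using csubspace_pair(3)[OF csubspace_adj gp(1) gp(1), of c] by (auto simp: Hplus_def)
  have "?B t = ?B a + c *\<^sub>C ?B gp"
    unfolding gp_eq using lin aH gpH cgpH by (simp add: clinear_on_def)
  moreover have "?B a = embed A a'" using a(1) by (simp add: quasi_kernel_def)
  moreover have "?B t = embed A t' - (\<i> * adj_K K t) *\<^sub>C K 1"
    using L_system_decomposition[OF L tM(1)] tM(2) by simp
  moreover have "embed A t' = embed A a' + c *\<^sub>C embed A (\<i> *\<^sub>C gp)"
  proof -
    have "t' = a' + c *\<^sub>C \<i> *\<^sub>C gp"
      using ta' unfolding c by (simp add: scaleC_scaleC mult.commute algebra_simps)
    then show ?thesis by (simp add: embed_add embed_scale)
  qed
  ultimately have "c *\<^sub>C ?B gp = c *\<^sub>C embed A (\<i> *\<^sub>C gp) - (\<i> * adj_K K t) *\<^sub>C K 1"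
    by (simp add: algebra_simps)
  then have "(1 / c) *\<^sub>C c *\<^sub>C ?B gp = (1 / c) *\<^sub>C (c *\<^sub>C embed A (\<i> *\<^sub>C gp) - (\<i> * adj_K K t) *\<^sub>C K 1)"
    by simp
  then have B: "?B gp = embed A (\<i> *\<^sub>C gp) + (- (\<i> * adj_K K t) / c) *\<^sub>C K 1"
    using \<open>c \<noteq> 0\<close> by (simp add: complex_vector.scale_right_diff_distrib scaleC_scaleC scaleC_one)
  \<comment> \<open>A vanishing coefficient would make \<open>gp\<close> an eigenvector of
    \<open>S\<close> for \<open>\<i>\<close>.\<close>
  have "- (\<i> * adj_K K t) / c \<noteq> 0"
  proof
    assume "- (\<i> * adj_K K t) / c = 0"
    then have "(gp, \<i> *\<^sub>C gp) \<in> ?S" using B gpH by (simp add: quasi_kernel_def)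
    from self_adjoint_no_eigenvalue[OF S this] gp(2) show False by simp
  qed
  then show ?thesis using B by (rule that)
qed

theorem theorem11:
  fixes A :: "('h::chilbert_space \<times> 'h) set"
    and \<AA> :: "'h \<Rightarrow> ('h \<Rightarrow> complex)"
    and K :: "complex \<Rightarrow> ('h \<Rightarrow> complex)"
    and \<kappa> :: real
  assumes "linear_operator A" and "closed A" and "densely_defined A"
    and "symmetric_operator A" and "deficiency_indices A = (1, 1)"
    and "L_system A \<AA> K"
    and "0 \<le> \<kappa>" and "\<kappa> < 1"
    and "von_Neumann_parameter A (main_operator A \<AA>) \<kappa>"
  shows "impedance A \<AA> K \<in> Donoghue_class \<longleftrightarrow> \<kappa> = 0"
proof -
  let ?B = "Re_op A \<AA>" and ?S = "quasi_kernel A (Re_op A \<AA>)" and ?M = "main_operator A \<AA>"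
  obtain gp gm where gp: "(gp, \<i> *\<^sub>C gp) \<in> adj A" "norm gp = 1"
    and gm: "(gm, (- \<i>) *\<^sub>C gm) \<in> adj A" "norm gm = 1"
    and dom: "gp - complex_of_real \<kappa> *\<^sub>C gm \<in> Domain ?M"
    using assms(9) by (auto simp: von_Neumann_parameter_def op_kernel_iff)
  have M: "csubspace ?M" "dissipative ?M"
    using assms(9) by (auto simp: von_Neumann_parameter_def maximal_dissipative_def linear_operator_def)
  note MA = L_system_main_operator_subset_adj[OF assms(6)]
  note lin = t_self_adjoint_bi_extension_quasi_kernel(1)[OF L_system_Re_op[OF assms(6)]]
    and S = t_self_adjoint_bi_extension_quasi_kernel(2)[OF L_system_Re_op[OF assms(6)]]
    and SA = t_self_adjoint_bi_extension_quasi_kernel(3)[OF L_system_Re_op[OF assms(6)]]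
    and sym = t_self_adjoint_bi_extension_symmetric[OF L_system_Re_op[OF assms(6)]]
  note AA = L_system_decomposition[OF assms(6)]
    and Kadd = L_system_adj_K_linear(1)[OF assms(6)] and Kscale = L_system_adj_K_linear(2)[OF assms(6)]
  obtain \<eta> where \<eta>: "\<eta> \<noteq> 0" "?B gp = embed A (\<i> *\<^sub>C gp) + \<eta> *\<^sub>C K 1"
    using L_system_deficiency_vector[OF assms(3,5,6,7,8) gp gm dom] by blast
  have gpH: "gp \<in> Hplus A" using gp(1) by (auto simp: Hplus_def)
  define p where "p = adj_K K gp"
  have scaleH: "c *\<^sub>C f \<in> Hplus A" if H: "f \<in> Hplus A" for c f
  proof -
    obtain f' where f: "(f, f') \<in> adj A" using H by (auto simp: Hplus_def)
    from csubspace_pair(3)[OF csubspace_adj f f] show ?thesis by (auto simp: Hplus_def)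
  qed
  have Bscale: "?B (c *\<^sub>C f) = c *\<^sub>C ?B f" if "f \<in> Hplus A" for c f
    using lin that by (simp add: clinear_on_def)
  \<comment> \<open>With \<open>f / \<eta>\<close> as preimage of \<open>K 1\<close>, evaluating the
    impedance reduces to solving \<open>(Re \<AA> - z) f = \<eta> K 1\<close>; at
    \<open>z = \<i>\<close> the vector \<open>gp\<close> does so.\<close>
  have impedance: "impedance A \<AA> K z = adj_K K f / \<eta>"
    if "Im z > 0" "f \<in> Hplus A" "?B f = embed A (z *\<^sub>C f) + \<eta> *\<^sub>C K 1" for z f
  proof -
    have "?B ((1 / \<eta>) *\<^sub>C f) - z *\<^sub>C embed A ((1 / \<eta>) *\<^sub>C f) = K 1"
      using that(2,3) \<eta>(1)
      by (simp add: Bscale embed_scale scaleC_add_right scaleC_scaleC scaleC_one mult.commute)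
    from impedance_eqI[where K = K, OF lin S _ scaleH[OF that(2)] this] that(1,2) show ?thesis
      by (simp add: Kscale)
  qed
  \<comment> \<open>Here \<open>\<AA> gp = \<i> gp + (\<eta> + \<i> p) K 1\<close>, so the question
    is whether the coefficient of \<open>K 1\<close> vanishes.\<close>
  have gp_main: "\<eta> = - \<i> * p \<longleftrightarrow> (gp, \<i> *\<^sub>C gp) \<in> ?M"
  proof
    assume "\<eta> = - \<i> * p"
    then show "(gp, \<i> *\<^sub>C gp) \<in> ?M"
      using AA[OF gpH] gpH
      by (simp add: main_operator_def quasi_kernel_def \<eta>(2) p_def add.assoc scaleC_add_left[symmetric])
  next
    assume "(gp, \<i> *\<^sub>C gp) \<in> ?M"
    then have "(\<eta> + \<i> * p) *\<^sub>C K 1 = 0"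
      using AA[OF gpH] by (simp add: main_operator_def quasi_kernel_def \<eta>(2) p_def add.assoc scaleC_add_left)
    moreover have "K 1 \<noteq> 0"
    proof
      assume "K 1 = 0"
      then have "(gp, \<i> *\<^sub>C gp) \<in> ?S" using \<eta>(2) gpH by (simp add: quasi_kernel_def)
      from self_adjoint_no_eigenvalue[OF S this] gp(2) show False by simp
    qed
    ultimately have "\<eta> + \<i> * p = 0" by (simp add: complex_vector.scale_eq_0_iff)
    then show "\<eta> = - \<i> * p" by (simp add: eq_neg_iff_add_eq_0)
  qed
  show ?thesis
  proof
    assume "impedance A \<AA> K \<in> Donoghue_class"
    from Donoghue_class_at_i[OF this] have "p / \<eta> = \<i>"
      using impedance[of \<i> gp] gpH \<eta>(2) by (simp add: p_def)
    then have "\<eta> = - \<i> * p" using \<eta>(1) by (simp add: field_simps)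
    then have "(gp, \<i> *\<^sub>C gp) \<in> ?M" using gp_main by simp
    moreover obtain t' where "(gp - complex_of_real \<kappa> *\<^sub>C gm, t') \<in> ?M" using dom by auto
    \<comment> \<open>Subtracting the two domain vectors leaves \<open>\<kappa> gm\<close>, on which
      the main operator acts as \<open>- \<i>\<close>; dissipativity then reads
      \<open>- \<kappa>^2 \<ge> 0\<close>.\<close>
    ultimately have gmM: "(complex_of_real \<kappa> *\<^sub>C gm, \<i> *\<^sub>C gp - t') \<in> ?M"
      using csubspace_pair(2)[OF M(1), of gp "\<i> *\<^sub>C gp" "gp - complex_of_real \<kappa> *\<^sub>C gm" t'] by simp
    moreover have "\<i> *\<^sub>C gp - t' = complex_of_real \<kappa> *\<^sub>C (- \<i>) *\<^sub>C gm"
      using adj_single_valued[OF assms(3)] MA gmM csubspace_pair(3)[OF csubspace_adj gm(1) gm(1)] by blast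
    ultimately have "0 \<le> Im (cinner (complex_of_real \<kappa> *\<^sub>C (- \<i>) *\<^sub>C gm) (complex_of_real \<kappa> *\<^sub>C gm))"
      using M(2) by (auto simp: dissipative_def)
    then have "\<kappa> * \<kappa> \<le> 0" by (simp add: cinner_simps cinner_self gm(2))
    then show "\<kappa> = 0" by (auto simp: mult_le_0_iff)
  next
    assume "\<kappa> = 0"
    then obtain g' where g': "(gp, g') \<in> ?M" using dom by auto
    moreover from this have "g' = \<i> *\<^sub>C gp" using MA adj_single_valued[OF assms(3) _ gp(1)] by blast
    ultimately have lam: "\<eta> = - \<i> * p" using gp_main by simp
    have K_cnj: "K 1 f = cnj (adj_K K f)" for f by (simp add: adj_K_def pairing_def)
    \<comment> \<open>The value of \<open>Re \<AA> gp\<close> at \<open>gp\<close> is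
      \<open>\<i> (1 - p cnj p)\<close>, and it must be real by symmetry.\<close>
    have "p * cnj p = 1"
    proof -
      have "?B gp gp = \<i> * (1 - p * cnj p)"
        unfolding \<eta>(2) lam
        by (simp add: embed_def gpH cinner_simps cinner_self gp(2) K_cnj p_def scaleC_fun_def
            scaleC_complex_def algebra_simps)
      moreover have "p * cnj p = of_real ((cmod p)\<^sup>2)" by (rule complex_norm_square[symmetric])
      moreover have "Im (?B gp gp) = 0" using sym[OF gpH gpH] by (metis Reals_cnj_iff complex_is_Real_iff)
      ultimately have "1 - (cmod p)\<^sup>2 = 0" by simp
      then show ?thesis using \<open>p * cnj p = of_real ((cmod p)\<^sup>2)\<close> by simp
    qed
    then have "p \<noteq> 0" by auto
    with \<open>p * cnj p = 1\<close> have p: "p \<noteq> 0" "cnj p = 1 / p" by (simp_all add: eq_divide_eq mult.commute)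
    show "impedance A \<AA> K \<in> Donoghue_class"
    proof (rule Donoghue_class_if_resolvent_form[OF S gp(2)])
      show "gp \<notin> Domain ?S"
      proof
        assume "gp \<in> Domain ?S"
        then obtain g' where "(gp, g') \<in> ?S" by auto
        moreover from this have "g' = \<i> *\<^sub>C gp" using SA adj_single_valued[OF assms(3) _ gp(1)] by blast
        ultimately show False using self_adjoint_no_eigenvalue[OF S, of gp \<i>] gp(2) by auto
      qed
      fix z :: complex assume z: "Im z > 0"
      obtain f f' where f: "(f, f') \<in> ?S" "f' - z *\<^sub>C f = gp"
        using self_adjoint_surj[OF S, of z gp] z by auto
      have fH: "f \<in> Hplus A" and Bf: "?B f = embed A f'" using f(1) by (auto simp: quasi_kernel_def)
      have f': "f' = gp + z *\<^sub>C f" using f(2) by (simp add: algebra_simps)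
      \<comment> \<open>The solution at \<open>\<i>\<close> is carried to \<open>z\<close>: since
        \<open>f' = gp + z f\<close>, applying \<open>Re \<AA>\<close> to \<open>F\<close> yields
        \<open>z F + \<eta> K 1\<close>.\<close>
      define F where "F = gp + (z - \<i>) *\<^sub>C f"
      have "F \<in> Hplus A"
      proof -
        have "(f, f') \<in> adj A" using f(1) SA by auto
        from csubspace_pair(1)[OF csubspace_adj gp(1) csubspace_pair(3)[OF csubspace_adj this this]]
        show ?thesis by (auto simp: F_def Hplus_def)
      qed
      moreover have "?B F = embed A (z *\<^sub>C F) + \<eta> *\<^sub>C K 1"
      proof -
        have "?B F = ?B gp + (z - \<i>) *\<^sub>C ?B f"
          using lin gpH fH scaleH[OF fH, of "z - \<i>"] by (simp add: F_def clinear_on_def)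
        also have "\<dots> = embed A (\<i> *\<^sub>C gp + (z - \<i>) *\<^sub>C f') + \<eta> *\<^sub>C K 1"
          by (simp only: \<eta>(2) Bf embed_add embed_scale add_ac)
        also have "\<i> *\<^sub>C gp + (z - \<i>) *\<^sub>C f' = z *\<^sub>C F"
          by (simp add: f' F_def scaleC_add_right scaleC_scaleC complex_vector.scale_left_diff_distrib
              complex_vector.scale_right_diff_distrib algebra_simps)
        finally show ?thesis .
      qed
      ultimately have "impedance A \<AA> K z = adj_K K F / \<eta>"
        using impedance[OF z] by blast
      also have "adj_K K F = p + (z - \<i>) * adj_K K f"
        using gpH fH scaleH[OF fH] by (simp add: F_def Kadd Kscale p_def)
      \<comment> \<open>Symmetry of \<open>Re \<AA>\<close> between \<open>f\<close> and
        \<open>gp\<close>, with \<open>Re \<AA>\<close> known on both, is an equation for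
        \<open>adj_K K f\<close>; \<open>cnj p = 1 / p\<close> solves it.\<close>
      also have "adj_K K f = p * (1 + (z + \<i>) * cinner f gp) / \<i>"
      proof -
        have "cinner f' gp = cnj (?B gp f)"
          using sym[OF fH gpH] gpH by (simp add: Bf embed_def)
        also have "\<dots> = - \<i> * cinner f gp + \<i> * cnj p * adj_K K f"
          unfolding \<eta>(2) lam using cinner_commute[of f gp]
          by (simp add: embed_def fH cinner_simps K_cnj scaleC_fun_def scaleC_complex_def)
        finally have "1 + (z + \<i>) * cinner f gp = \<i> / p * adj_K K f"
          by (simp add: f' cinner_simps cinner_self gp(2) p algebra_simps)
        then show ?thesis using p(1) by simp
      qed
      also have "(p + (z - \<i>) * (p * (1 + (z + \<i>) * cinner f gp) / \<i>)) / \<eta> = z + (1 + z\<^sup>2) * cinner f gp"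
        unfolding lam using p(1) by (simp add: field_simps power2_eq_square)
      finally show "\<exists>f f'. (f, f') \<in> ?S \<and> f' - z *\<^sub>C f = gp
          \<and> impedance A \<AA> K z = z + (1 + z\<^sup>2) * cinner f gp"
        using f by blast
    qed
  qed
qed

end
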